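(* Let $M$ be a smooth $n$-dimensional manifold with an exact volume form $\Omega$, let $\alpha,\tilde\alpha$ be $(n-1)$-forms on $M$ with $d\alpha=d\tilde\alpha=\Omega$, and let $N=M\times M$. If an $(n-2)$-form $\Lambda$ on $N$ generates a map $f:M\to M$ with respect to $(\alpha,\tilde\alpha)$, then $f$ is exact volume-preserving with respect to the pair $(\alpha,\tilde\alpha)$, with $$f^*\tilde\alpha-\alpha=d\lambda,\qquad \lambda=j^*\Lambda,$$ where $j:M\to N$ is the embedding $j(m)=(m,f(m))$.
   Context: Let $\pi_1,\pi_2:N=M\times M\to M$ be the projections $\pi_1(m_1,m_2)=m_1$, $\pi_2(m_1,m_2)=m_2$. Definition. An $(n-2)$-form $\Lambda$ on $N$ is a generating form with respect to $(\alpha,\tilde\alpha)$ if the set of points of $N$ at which the $(n-1)$-form $\Gamma=\pi_2^*\tilde\alpha-\pi_1^*\alpha-d\Lambda$ vanishes (as a section, i.e. $\Gamma$ is the zero multilinear form at that point) is the graph $\{(m,f(m)) : m\in M\}$ of a smooth function $f:M\to M$. In that case $f$ is said to be generated by $\Lambda$ with respect to $(\alpha,\tilde\alpha)$. A smooth map $f:M\to M$ is exact volume-preserving with respect to the pair $(\alpha,\tilde\alpha)$ if there is an $(n-2)$-form $\lambda$ on $M$ such that $f^*\tilde\alpha-\alpha=d\lambda$. *)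

theory Defs
  imports "HOL-Analysis.Analysis"
begin

section \<open>Smooth maps between Euclidean spaces\<close>

text \<open>
  For an open set \<open>S\<close> (the only case used below) these are the usual classes
  \<open>C\<^sup>k\<close> and \<open>C\<^sup>\<infinity>\<close>.
\<close>

primrec Ck_on ::
  "nat \<Rightarrow> 'a::euclidean_space set \<Rightarrow> ('a \<Rightarrow> 'b::real_normed_vector) \<Rightarrow> bool"
where
  "Ck_on 0 S f \<longleftrightarrow> continuous_on S f"
| "Ck_on (Suc k) S f \<longleftrightarrow>
     (\<forall>x\<in>S. f differentiable (at x)) \<and>
     (\<forall>v. Ck_on k S (\<lambda>x. frechet_derivative f (at x) v))"

definition smooth_on ::
  "'a::euclidean_space set \<Rightarrow> ('a \<Rightarrow> 'b::real_normed_vector) \<Rightarrow> bool" where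
  "smooth_on S f \<longleftrightarrow> (\<forall>k. Ck_on k S f)"


section \<open>Smooth manifolds\<close>

text \<open>
  A chart is a pair of its domain and its coordinate map; the values of the coordinate
  map outside the domain are irrelevant.  A smooth manifold of dimension \<open>DIM('e)\<close> is a
  Hausdorff, second countable type \<open>'m\<close> together with a smooth atlas of charts into \<open>'e\<close>.
  The atlas need not be maximal: all notions below depend only on the smooth structure
  generated by it.
\<close>

type_synonym ('m, 'e) chart = "'m set \<times> ('m \<Rightarrow> 'e)"

abbreviation chart_dom :: "('m, 'e) chart \<Rightarrow> 'm set" where
  "chart_dom c \<equiv> fst c"

abbreviation chart_map :: "('m, 'e) chart \<Rightarrow> 'm \<Rightarrow> 'e" where
  "chart_map c \<equiv> snd c"

definition chart_inv :: "('m, 'e) chart \<Rightarrow> 'e \<Rightarrow> 'm" where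
  "chart_inv c = inv_into (chart_dom c) (chart_map c)"

definition transition :: "('m, 'e) chart \<Rightarrow> ('m, 'e) chart \<Rightarrow> 'e \<Rightarrow> 'e" where
  "transition c d = chart_map d \<circ> chart_inv c"

definition is_chart ::
  "('m::topological_space, 'e::euclidean_space) chart \<Rightarrow> bool" where
  "is_chart c \<longleftrightarrow>
     open (chart_dom c) \<and>
     open (chart_map c ` chart_dom c) \<and>
     homeomorphism (chart_dom c) (chart_map c ` chart_dom c) (chart_map c) (chart_inv c)"

definition smooth_atlas ::
  "('m::{t2_space,second_countable_topology}, 'e::euclidean_space) chart set \<Rightarrow> bool" where
  "smooth_atlas A \<longleftrightarrow>
     (\<forall>c\<in>A. is_chart c) \<and>
     (\<Union>c\<in>A. chart_dom c) = UNIV \<and>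
     (\<forall>c\<in>A. \<forall>d\<in>A. smooth_on (chart_map c ` (chart_dom c \<inter> chart_dom d)) (transition c d))"

definition prod_atlas ::
  "('m, 'e) chart set \<Rightarrow> ('n, 'f) chart set \<Rightarrow> ('m \<times> 'n, 'e \<times> 'f) chart set" where
  "prod_atlas A B =
     {(chart_dom c \<times> chart_dom d, map_prod (chart_map c) (chart_map d)) | c d. c \<in> A \<and> d \<in> B}"

definition chart_at :: "('m, 'e) chart set \<Rightarrow> 'm \<Rightarrow> ('m, 'e) chart" where
  "chart_at A p = (SOME c. c \<in> A \<and> p \<in> chart_dom c)"

definition smooth_map ::
  "('m::topological_space, 'e::euclidean_space) chart set \<Rightarrow>
   ('n::topological_space, 'f::euclidean_space) chart set \<Rightarrow> ('m \<Rightarrow> 'n) \<Rightarrow> bool" where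
  "smooth_map A B f \<longleftrightarrow>
     continuous_on UNIV f \<and>
     (\<forall>c\<in>A. \<forall>d\<in>B.
        smooth_on (chart_map c ` (chart_dom c \<inter> f -` chart_dom d))
          (chart_map d \<circ> f \<circ> chart_inv c))"


section \<open>Tangent vectors\<close>

text \<open>
  A tangent vector at \<open>p\<close> assigns to every chart around \<open>p\<close> its coordinate vector, subject to
  the transformation law given by the derivatives of the transition maps.  Requiring the value
  zero on all other charts makes this representation unique.  The vector space operations on
  tangent vectors are pointwise.
\<close>

type_synonym ('m, 'e) tangent = "('m, 'e) chart \<Rightarrow> 'e"

definition tangent_space ::
  "('m, 'e::euclidean_space) chart set \<Rightarrow> 'm \<Rightarrow> ('m, 'e) tangent set" where
  "tangent_space A p =
     {v. (\<forall>c\<in>A. \<forall>d\<in>A. p \<in> chart_dom c \<longrightarrow> p \<in> chart_dom d \<longrightarrow>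
            v d = frechet_derivative (transition c d) (at (chart_map c p)) (v c)) \<and>
         (\<forall>c. \<not> (c \<in> A \<and> p \<in> chart_dom c) \<longrightarrow> v c = 0)}"

text \<open>The tangent vector at \<open>p\<close> whose coordinate vector in the chart \<open>c\<close> is \<open>u\<close>.\<close>

definition tangent_of_coords ::
  "('m, 'e::euclidean_space) chart set \<Rightarrow> ('m, 'e) chart \<Rightarrow> 'm \<Rightarrow> 'e \<Rightarrow> ('m, 'e) tangent" where
  "tangent_of_coords A c p u =
     (\<lambda>d. if d \<in> A \<and> p \<in> chart_dom d
          then frechet_derivative (transition c d) (at (chart_map c p)) u else 0)"

text \<open>The tangent map of \<open>f\<close> at \<open>p\<close>; by the chain rule the choice of the chart at \<open>p\<close> is
  immaterial.\<close>

definition tangent_map ::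
  "('m, 'e::euclidean_space) chart set \<Rightarrow> ('n, 'f::euclidean_space) chart set \<Rightarrow>
   ('m \<Rightarrow> 'n) \<Rightarrow> 'm \<Rightarrow> ('m, 'e) tangent \<Rightarrow> ('n, 'f) tangent" where
  "tangent_map A B f p v =
     (let c = chart_at A p in
      (\<lambda>d. if d \<in> B \<and> f p \<in> chart_dom d
           then frechet_derivative (chart_map d \<circ> f \<circ> chart_inv c) (at (chart_map c p)) (v c)
           else 0))"


section \<open>Differential forms\<close>

text \<open>
  A \<open>k\<close>-form takes a point \<open>p\<close> and a list of \<open>k\<close> tangent vectors at \<open>p\<close>.  Only values on
  such lists matter, so equality of forms is expressed by \<open>form_eq\<close> rather than \<open>=\<close>.
\<close>

type_synonym ('m, 'e) form = "'m \<Rightarrow> ('m, 'e) tangent list \<Rightarrow> real"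

definition alternating_multilinear ::
  "nat \<Rightarrow> ('c \<Rightarrow> 'e::real_vector) set \<Rightarrow> (('c \<Rightarrow> 'e) list \<Rightarrow> real) \<Rightarrow> bool" where
  "alternating_multilinear k T w \<longleftrightarrow>
     (\<forall>vs\<in>lists T. length vs = k \<longrightarrow>
        (\<forall>i<k. \<forall>x\<in>T. \<forall>y\<in>T. \<forall>a b.
           w (vs[i := (\<lambda>c. a *\<^sub>R x c + b *\<^sub>R y c)]) = a * w (vs[i := x]) + b * w (vs[i := y])) \<and>
        (\<forall>i<k. \<forall>j<k. i \<noteq> j \<longrightarrow> vs ! i = vs ! j \<longrightarrow> w vs = 0))"

definition local_form ::
  "('m, 'e::euclidean_space) chart set \<Rightarrow> ('m, 'e) chart \<Rightarrow> ('m, 'e) form \<Rightarrow>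
   'e \<Rightarrow> 'e list \<Rightarrow> real" where
  "local_form A c \<omega> x us =
     \<omega> (chart_inv c x) (map (tangent_of_coords A c (chart_inv c x)) us)"

definition differential_form ::
  "('m, 'e::euclidean_space) chart set \<Rightarrow> nat \<Rightarrow> ('m, 'e) form \<Rightarrow> bool" where
  "differential_form A k \<omega> \<longleftrightarrow>
     (\<forall>p. alternating_multilinear k (tangent_space A p) (\<omega> p)) \<and>
     (\<forall>c\<in>A. \<forall>us. length us = k \<longrightarrow>
        smooth_on (chart_map c ` chart_dom c) (\<lambda>x. local_form A c \<omega> x us))"

definition form_eq ::
  "('m, 'e::euclidean_space) chart set \<Rightarrow> nat \<Rightarrow> ('m, 'e) form \<Rightarrow> ('m, 'e) form \<Rightarrow> bool" where
  "form_eq A k \<omega> \<eta> \<longleftrightarrow>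
     (\<forall>p. \<forall>vs\<in>lists (tangent_space A p). length vs = k \<longrightarrow> \<omega> p vs = \<eta> p vs)"

definition form_diff :: "('m, 'e) form \<Rightarrow> ('m, 'e) form \<Rightarrow> ('m, 'e) form" where
  "form_diff \<omega> \<eta> = (\<lambda>p vs. \<omega> p vs - \<eta> p vs)"

definition form_vanishes_at ::
  "('m, 'e::euclidean_space) chart set \<Rightarrow> nat \<Rightarrow> ('m, 'e) form \<Rightarrow> 'm \<Rightarrow> bool" where
  "form_vanishes_at A k \<omega> p \<longleftrightarrow>
     (\<forall>vs\<in>lists (tangent_space A p). length vs = k \<longrightarrow> \<omega> p vs = 0)"

definition pullback ::
  "('m, 'e::euclidean_space) chart set \<Rightarrow> ('n, 'f::euclidean_space) chart set \<Rightarrow>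
   ('m \<Rightarrow> 'n) \<Rightarrow> ('n, 'f) form \<Rightarrow> ('m, 'e) form" where
  "pullback A B f \<omega> p vs = \<omega> (f p) (map (tangent_map A B f p) vs)"

text \<open>
  The exterior derivative on an open subset of a Euclidean space, for constant arguments:
  \<open>(d\<eta>)\<^sub>x(u\<^sub>0,\<dots>,u\<^sub>k) = \<Sum>i. (-1)\<^sup>i D\<^bsub>u\<^sub>i\<^esub> (\<eta>(u\<^sub>0,\<dots>,u\<^sub>k without u\<^sub>i))(x)\<close>, with no factor
  \<open>1/(k+1)\<close>.
\<close>

definition euclidean_ext_deriv ::
  "('e::euclidean_space \<Rightarrow> 'e list \<Rightarrow> real) \<Rightarrow> 'e \<Rightarrow> 'e list \<Rightarrow> real" where
  "euclidean_ext_deriv \<eta> x us =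
     (\<Sum>i<length us. (-1) ^ i *
        frechet_derivative (\<lambda>y. \<eta> y (take i us @ drop (Suc i) us)) (at x) (us ! i))"

text \<open>
  On a manifold the exterior derivative at \<open>p\<close> is computed in a chart around \<open>p\<close>; for smooth
  forms the result does not depend on the chart.
\<close>

definition ext_deriv ::
  "('m, 'e::euclidean_space) chart set \<Rightarrow> ('m, 'e) form \<Rightarrow> ('m, 'e) form" where
  "ext_deriv A \<omega> p vs =
     (let c = chart_at A p in
      euclidean_ext_deriv (local_form A c \<omega>) (chart_map c p) (map (\<lambda>v. v c) vs))"

definition volume_form ::
  "('m, 'e::euclidean_space) chart set \<Rightarrow> ('m, 'e) form \<Rightarrow> bool" where
  "volume_form A \<Omega> \<longleftrightarrow>
     differential_form A DIM('e) \<Omega> \<and> (\<forall>p. \<not> form_vanishes_at A DIM('e) \<Omega> p)"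

definition exact_form ::
  "('m, 'e::euclidean_space) chart set \<Rightarrow> nat \<Rightarrow> ('m, 'e) form \<Rightarrow> bool" where
  "exact_form A k \<omega> \<longleftrightarrow>
     k \<ge> 1 \<and> (\<exists>\<beta>. differential_form A (k - 1) \<beta> \<and> form_eq A k (ext_deriv A \<beta>) \<omega>)"


section \<open>Generating forms and exact volume-preserving maps\<close>

text \<open>
  Below \<open>\<alpha>\<close> and \<open>\<alpha>'\<close> are forms of degree \<open>DIM('e) - 1\<close>, and \<open>DIM('e) \<ge> 2\<close>, so that
  forms of degree \<open>DIM('e) - 2\<close> make sense.
\<close>

definition generating_defect ::
  "('m, 'e::euclidean_space) chart set \<Rightarrow> ('m, 'e) form \<Rightarrow> ('m, 'e) form \<Rightarrow>
   ('m \<times> 'm, 'e \<times> 'e) form \<Rightarrow> ('m \<times> 'm, 'e \<times> 'e) form" where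
  "generating_defect A \<alpha> \<alpha>' \<Lambda> =
     form_diff
       (form_diff (pullback (prod_atlas A A) A snd \<alpha>') (pullback (prod_atlas A A) A fst \<alpha>))
       (ext_deriv (prod_atlas A A) \<Lambda>)"

definition generates ::
  "('m::topological_space, 'e::euclidean_space) chart set \<Rightarrow> ('m, 'e) form \<Rightarrow> ('m, 'e) form \<Rightarrow>
   ('m \<times> 'm, 'e \<times> 'e) form \<Rightarrow> ('m \<Rightarrow> 'm) \<Rightarrow> bool" where
  "generates A \<alpha> \<alpha>' \<Lambda> f \<longleftrightarrow>
     differential_form (prod_atlas A A) (DIM('e) - 2) \<Lambda> \<and>
     smooth_map A A f \<and>
     {q. form_vanishes_at (prod_atlas A A) (DIM('e) - 1) (generating_defect A \<alpha> \<alpha>' \<Lambda>) q}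
       = {(m, f m) | m. True}"

definition exact_volume_preserving ::
  "('m::topological_space, 'e::euclidean_space) chart set \<Rightarrow> ('m, 'e) form \<Rightarrow> ('m, 'e) form \<Rightarrow>
   ('m \<Rightarrow> 'm) \<Rightarrow> bool" where
  "exact_volume_preserving A \<alpha> \<alpha>' f \<longleftrightarrow>
     smooth_map A A f \<and>
     (\<exists>\<beta>. differential_form A (DIM('e) - 2) \<beta> \<and>
        form_eq A (DIM('e) - 1) (form_diff (pullback A A f \<alpha>') \<alpha>) (ext_deriv A \<beta>))"

end

theory Submission
  imports Defs
begin

text \<open>
  On the graph of \<open>f\<close> the defect \<open>\<pi>\<^sub>2\<^sup>*\<alpha>' - \<pi>\<^sub>1\<^sup>*\<alpha> - d\<Lambda>\<close> vanishes, so its pullback along \<open>j\<close> is zero.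
  Since \<open>\<pi>\<^sub>2 \<circ> j = f\<close>, \<open>\<pi>\<^sub>1 \<circ> j = id\<close> and \<open>j\<^sup>* \<circ> d = d \<circ> j\<^sup>*\<close>, this pullback is
  \<open>f\<^sup>*\<alpha>' - \<alpha> - d(j\<^sup>*\<Lambda>)\<close>.  That \<open>d\<close> commutes with pullbacks is a computation in charts: in
  \<open>d(F\<^sup>*\<omega>)\<close> the terms containing \<open>D\<^sup>2F\<close> cancel in pairs, by the symmetry of the second
  derivative and the alternation of \<open>\<omega>\<close>.
\<close>

section \<open>Calculus of smooth maps\<close>

text \<open>Smoothness is given only along constant data: \<open>Ck_on\<close> differentiates in a
  fixed direction, and \<open>differential_form\<close> requires smooth values on fixed coordinate
  vectors. In a pullback the arguments are DF_x(u), which move with x. The recurring device is to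
  expand a moving vector in \<open>Basis\<close>, trading it for scalar coefficients times values on
  constant vectors. This gives the chain rule in all orders, the smoothness of a pullback, and the
  product rule that produces the terms with second derivatives. The second obstacle is that
  \<open>tangent_map\<close> and \<open>ext_deriv\<close> evaluate in charts picked by
  \<open>chart_at\<close>. Change of charts is treated as the coordinate expression of
  \<open>id\<close>, so one chain rule serves both transition maps and maps between manifolds, and
  \<open>local_form_pullback\<close> then turns a pullback on manifolds into one between open sets
  of Euclidean spaces.\<close>

lemma Ck_on_subset:
  "Ck_on k S f \<Longrightarrow> T \<subseteq> S \<Longrightarrow> Ck_on k T f"
  by (induction k arbitrary: f) (auto intro: continuous_on_subset)

text \<open>Openness lets the derivative at a point of \<open>S\<close> depend only on values in
  \<open>S\<close>; hence the derivatives again agree on \<open>S\<close> and the induction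
  continues.\<close>

lemma Ck_on_cong:
  assumes "open S" and "\<And>x. x \<in> S \<Longrightarrow> f x = g x"
  shows "Ck_on k S f \<longleftrightarrow> Ck_on k S g"
  using assms(2)
proof (induction k arbitrary: f g)
  case 0
  then show ?case by (simp cong: continuous_on_cong)
next
  case (Suc k)
  have d: "f differentiable (at x) \<longleftrightarrow> g differentiable (at x)" if "x \<in> S" for x
    unfolding differentiable_def using Suc.prems that assms(1)
    by (metis has_derivative_transform_within_open)
  have "frechet_derivative f (at x) v = frechet_derivative g (at x) v"
    if "x \<in> S" "f differentiable (at x)" for x v
    using frechet_derivative_transform_within_open[OF that(2) assms(1) that(1)] Suc.prems by metis
  then show ?case using Suc.IH d unfolding Ck_on.simps by (smt (verit, best))
qed

lemma Ck_on_Suc_imp: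
  "Ck_on (Suc k) S f \<Longrightarrow> Ck_on k S f"
proof (induction k arbitrary: f)
  case 0
  then show ?case
    by (auto intro!: differentiable_imp_continuous_on
        simp: differentiable_on_def differentiable_at_withinI)
next
  case (Suc k)
  then show ?case by (metis Ck_on.simps(2))
qed

lemma smooth_on_imp_Ck_on: "smooth_on S f \<Longrightarrow> Ck_on k S f"
  by (simp add: smooth_on_def)

lemma smooth_on_differentiable:
  "smooth_on S f \<Longrightarrow> x \<in> S \<Longrightarrow> f differentiable (at x)"
  using smooth_on_imp_Ck_on[of S f "Suc 0"] by simp

lemma smooth_on_subset:
  "smooth_on S f \<Longrightarrow> T \<subseteq> S \<Longrightarrow> smooth_on T f"
  using Ck_on_subset unfolding smooth_on_def by blast

lemma smooth_on_cong:
  assumes "open S" and "\<And>x. x \<in> S \<Longrightarrow> f x = g x"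
  shows "smooth_on S f \<longleftrightarrow> smooth_on S g"
  unfolding smooth_on_def by (intro iff_allI Ck_on_cong assms)

lemma smooth_on_frechet_derivative:
  assumes "smooth_on S f"
  shows "smooth_on S (\<lambda>x. frechet_derivative f (at x) v)"
  unfolding smooth_on_def
proof
  fix k
  show "Ck_on k S (\<lambda>x. frechet_derivative f (at x) v)"
    using smooth_on_imp_Ck_on[OF assms, of "Suc k"] by simp
qed

lemma Ck_on_local:
  assumes "\<And>x. x \<in> S \<Longrightarrow> \<exists>T. open T \<and> x \<in> T \<and> Ck_on k T f"
  shows "Ck_on k S f"
  using assms
proof (induction k arbitrary: f)
  case 0
  then show ?case
    unfolding Ck_on.simps
    by (metis continuous_at_imp_continuous_at_within continuous_on_eq_continuous_at
        continuous_on_eq_continuous_within)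
next
  case (Suc k)
  have "f differentiable (at x)" if "x \<in> S" for x
    using Suc.prems[OF that] by auto
  moreover have "Ck_on k S (\<lambda>x. frechet_derivative f (at x) v)" for v
    by (rule Suc.IH) (use Suc.prems in fastforce)
  ultimately show ?case by simp
qed

text \<open>Used for pullbacks: their coordinate expression is known only on the part of a chart
  that is mapped into a single chart of the target.\<close>

lemma smooth_on_local:
  assumes "\<And>x. x \<in> S \<Longrightarrow> \<exists>T. open T \<and> x \<in> T \<and> smooth_on T f"
  shows "smooth_on S f"
  unfolding smooth_on_def using assms by (metis Ck_on_local smooth_on_def)

section \<open>Closure of the smoothness classes under sums, products and composition\<close>

lemma Ck_on_const: "Ck_on k S (\<lambda>x. c)"
  by (induction k arbitrary: c) auto

lemma Ck_on_add:
  assumes "open S"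
  shows "Ck_on k S f \<Longrightarrow> Ck_on k S g \<Longrightarrow> Ck_on k S (\<lambda>x. f x + g x)"
proof (induction k arbitrary: f g)
  case 0
  then show ?case by (auto intro: continuous_on_add)
next
  case (Suc k)
  have "Ck_on k S (\<lambda>x. frechet_derivative (\<lambda>x. f x + g x) (at x) v)" for v
  proof -
    have "frechet_derivative (\<lambda>x. f x + g x) (at x) v =
        frechet_derivative f (at x) v + frechet_derivative g (at x) v" if "x \<in> S" for x
    proof -
      have "((\<lambda>x. f x + g x) has_derivative
        (\<lambda>v. frechet_derivative f (at x) v + frechet_derivative g (at x) v)) (at x)"
        using Suc.prems that by (auto intro!: has_derivative_add simp: frechet_derivative_works[symmetric])
      then show ?thesis by (simp flip: frechet_derivative_at)
    qed
    moreover have "Ck_on k S (\<lambda>x. frechet_derivative f (at x) v + frechet_derivative g (at x) v)"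
      by (rule Suc.IH) (use Suc.prems in auto)
    ultimately show ?thesis by (rule Ck_on_cong[OF assms, THEN iffD2])
  qed
  then show ?case using Suc.prems by (auto intro: differentiable_add)
qed

lemma Ck_on_sum:
  assumes "open S" "finite I" "\<And>i. i \<in> I \<Longrightarrow> Ck_on k S (f i)"
  shows "Ck_on k S (\<lambda>x. \<Sum>i\<in>I. f i x)"
  using assms(2,3)
  by (induction I rule: finite_induct) (auto intro: Ck_on_add[OF assms(1)] Ck_on_const)

lemma Ck_on_bounded_linear:
  assumes "open S" and L: "bounded_linear L"
  shows "Ck_on k S f \<Longrightarrow> Ck_on k S (\<lambda>x. L (f x))"
proof (induction k arbitrary: f)
  case 0
  then show ?case using L by (auto intro: bounded_linear.continuous_on)
next
  case (Suc k)
  have D: "((\<lambda>x. L (f x)) has_derivative (\<lambda>v. L (frechet_derivative f (at x) v))) (at x)"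
    if "x \<in> S" for x
    using Suc.prems that
    by (auto intro!: bounded_linear.has_derivative[OF L] simp: frechet_derivative_works[symmetric])
  have "Ck_on k S (\<lambda>x. frechet_derivative (\<lambda>x. L (f x)) (at x) v)" for v
  proof -
    have "frechet_derivative (\<lambda>x. L (f x)) (at x) v = L (frechet_derivative f (at x) v)"
      if "x \<in> S" for x
      by (simp flip: frechet_derivative_at[OF D[OF that]])
    moreover have "Ck_on k S (\<lambda>x. L (frechet_derivative f (at x) v))"
      by (rule Suc.IH) (use Suc.prems in auto)
    ultimately show ?thesis by (rule Ck_on_cong[OF assms(1), THEN iffD2])
  qed
  then show ?case using D by (auto simp: differentiable_def)
qed

lemma Ck_on_scaleR:
  assumes "open S"
  shows "Ck_on k S f \<Longrightarrow> Ck_on k S g \<Longrightarrow> Ck_on k S (\<lambda>x. f x *\<^sub>R g x)"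
proof (induction k arbitrary: f g)
  case 0
  then show ?case by (auto intro: continuous_on_scaleR)
next
  case (Suc k)
  have D: "((\<lambda>x. f x *\<^sub>R g x) has_derivative
      (\<lambda>v. f x *\<^sub>R frechet_derivative g (at x) v + frechet_derivative f (at x) v *\<^sub>R g x)) (at x)"
    if "x \<in> S" for x
    using Suc.prems that
    by (auto intro!: has_derivative_scaleR simp: frechet_derivative_works[symmetric])
  have "Ck_on k S (\<lambda>x. frechet_derivative (\<lambda>x. f x *\<^sub>R g x) (at x) v)" for v
  proof -
    have "frechet_derivative (\<lambda>x. f x *\<^sub>R g x) (at x) v =
        f x *\<^sub>R frechet_derivative g (at x) v + frechet_derivative f (at x) v *\<^sub>R g x"
      if "x \<in> S" for x
      by (simp flip: frechet_derivative_at[OF D[OF that]])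
    moreover have "Ck_on k S
        (\<lambda>x. f x *\<^sub>R frechet_derivative g (at x) v + frechet_derivative f (at x) v *\<^sub>R g x)"
      \<comment> \<open>Each Leibniz term keeps one undifferentiated factor, whose order has to be
        lowered to \<open>k\<close> to match that of the derivative.\<close>
      using Suc.prems Suc.prems[THEN Ck_on_Suc_imp]
      by (intro Ck_on_add[OF assms] Suc.IH) simp_all
    ultimately show ?thesis by (rule Ck_on_cong[OF assms, THEN iffD2])
  qed
  then show ?case using D by (auto simp: differentiable_def)
qed

lemma linear_sum_Basis:
  fixes L :: "'a::euclidean_space \<Rightarrow> 'b::real_vector"
  assumes "linear L"
  shows "L u = (\<Sum>b\<in>Basis. (u \<bullet> b) *\<^sub>R L b)"
proof -
  have "L u = L (\<Sum>b\<in>Basis. (u \<bullet> b) *\<^sub>R b)" by (simp add: euclidean_representation)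
  also have "\<dots> = (\<Sum>b\<in>Basis. (u \<bullet> b) *\<^sub>R L b)"
    using assms by (simp add: linear_sum linear_cmul)
  finally show ?thesis .
qed

text \<open>By the chain rule Dg is evaluated in the direction Df_x(v), which depends on x, whereas
  \<open>Ck_on\<close> speaks of fixed directions. Expanding that direction in \<open>Basis\<close>
  leaves products of its components with fixed-direction derivatives of \<open>g\<close> composed
  with \<open>f\<close>; the induction hypothesis, general in \<open>g\<close>, applies to
  these.\<close>

lemma Ck_on_compose:
  fixes f :: "'a::euclidean_space \<Rightarrow> 'b::euclidean_space" and g :: "'b \<Rightarrow> 'c::real_normed_vector"
  assumes "open S" and "f ` S \<subseteq> T"
  shows "Ck_on k S f \<Longrightarrow> Ck_on k T g \<Longrightarrow> Ck_on k S (g \<circ> f)"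
proof (induction k arbitrary: g)
  case 0
  then show ?case using assms
    by (metis Ck_on.simps(1) continuous_on_compose continuous_on_subset)
next
  case (Suc k)
  have fd: "f differentiable (at x)" and gd: "g differentiable (at (f x))" if "x \<in> S" for x
    using Suc.prems that assms(2) by auto
  have "Ck_on k S (\<lambda>x. frechet_derivative (g \<circ> f) (at x) v)" for v
  proof -
    have "frechet_derivative (g \<circ> f) (at x) v =
        (\<Sum>b\<in>Basis. (frechet_derivative f (at x) v \<bullet> b) *\<^sub>R
          ((\<lambda>y. frechet_derivative g (at y) b) \<circ> f) x)" if "x \<in> S" for x
      by (simp only: frechet_derivative_compose[OF fd[OF that] gd[OF that]] o_apply)
        (rule linear_sum_Basis[OF linear_frechet_derivative[OF gd[OF that]]])
    moreover have "Ck_on k S (\<lambda>x. \<Sum>b\<in>Basis. (frechet_derivative f (at x) v \<bullet> b) *\<^sub>R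
          ((\<lambda>y. frechet_derivative g (at y) b) \<circ> f) x)"
      using Suc.prems Suc.prems(1)[THEN Ck_on_Suc_imp]
      by (intro Ck_on_sum Ck_on_scaleR assms(1) finite_Basis Suc.IH
          Ck_on_bounded_linear[OF assms(1) bounded_linear_inner_left]) simp_all
    ultimately show ?thesis by (rule Ck_on_cong[OF assms(1), THEN iffD2])
  qed
  then show ?case using fd gd unfolding Ck_on.simps by (blast intro: differentiable_chain_at)
qed

lemma smooth_on_compose:
  fixes f :: "'a::euclidean_space \<Rightarrow> 'b::euclidean_space" and g :: "'b \<Rightarrow> 'c::real_normed_vector"
  assumes "open S" "f ` S \<subseteq> T" "smooth_on S f" "smooth_on T g"
  shows "smooth_on S (g \<circ> f)"
  using assms Ck_on_compose unfolding smooth_on_def by blast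

lemma smooth_on_scaleR:
  "open S \<Longrightarrow> smooth_on S f \<Longrightarrow> smooth_on S g \<Longrightarrow> smooth_on S (\<lambda>x. f x *\<^sub>R g x)"
  unfolding smooth_on_def using Ck_on_scaleR by blast

lemma smooth_on_sum:
  "open S \<Longrightarrow> finite I \<Longrightarrow> (\<And>i. i \<in> I \<Longrightarrow> smooth_on S (f i)) \<Longrightarrow> smooth_on S (\<lambda>x. \<Sum>i\<in>I. f i x)"
  unfolding smooth_on_def using Ck_on_sum by blast

lemma smooth_on_bounded_linear:
  "open S \<Longrightarrow> bounded_linear L \<Longrightarrow> smooth_on S f \<Longrightarrow> smooth_on S (\<lambda>x. L (f x))"
  unfolding smooth_on_def using Ck_on_bounded_linear by blast

lemma smooth_on_ident: "smooth_on S (\<lambda>x. x)"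
  unfolding smooth_on_def
proof
  fix k show "Ck_on k S (\<lambda>x. x)" by (cases k) (auto intro: Ck_on_const)
qed

lemma smooth_on_linear:
  "open S \<Longrightarrow> bounded_linear L \<Longrightarrow> smooth_on S L"
  using smooth_on_bounded_linear[OF _ _ smooth_on_ident] .

lemma smooth_on_Pair:
  assumes "open S" "smooth_on S f" "smooth_on S g"
  shows "smooth_on S (\<lambda>x. (f x, g x))"
proof -
  have "bounded_linear (\<lambda>x. (x, 0))" "bounded_linear (\<lambda>x. (0, x))"
    by (auto intro: bounded_linear_Pair bounded_linear_ident bounded_linear_zero)
  then have "smooth_on S (\<lambda>x. (f x, 0))" "smooth_on S (\<lambda>x. (0, g x))"
    using smooth_on_bounded_linear assms by fastforce+
  then have "smooth_on S (\<lambda>x. (f x, 0) + (0, g x))"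
    unfolding smooth_on_def using Ck_on_add[OF assms(1)] by blast
  then show ?thesis by simp
qed


section \<open>Symmetry of the second derivative\<close>

text \<open>Restriction to a line, so that the mean value theorem of one variable becomes
  available.\<close>

lemma has_real_derivative_along_line:
  assumes "g differentiable (at (p + s *\<^sub>R u))"
  shows "((\<lambda>s. g (p + s *\<^sub>R u)) has_real_derivative
    frechet_derivative g (at (p + s *\<^sub>R u)) u) (at s)"
proof -
  let ?D = "frechet_derivative g (at (p + s *\<^sub>R u))"
  have "((\<lambda>s. p + s *\<^sub>R u) has_derivative (\<lambda>t. t *\<^sub>R u)) (at s)"
    by (auto intro!: derivative_eq_intros)
  moreover have "(g has_derivative ?D) (at (p + s *\<^sub>R u))"
    using assms by (simp add: frechet_derivative_works)
  ultimately have "((\<lambda>s. g (p + s *\<^sub>R u)) has_derivative (\<lambda>t. ?D (t *\<^sub>R u))) (at s)"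
    by (rule has_derivative_compose)
  moreover have "?D (t *\<^sub>R u) = ?D u * t" for t
    using linear_cmul[OF linear_frechet_derivative[OF assms]] by (simp add: mult.commute)
  ultimately show ?thesis by (simp add: has_field_derivative_def)
qed

text \<open>Two applications of the mean value theorem, first along \<open>u\<close> and then along
  \<open>v\<close>. The left-hand side does not change when \<open>u\<close> and \<open>v\<close>
  trade places, which is what forces the mixed derivatives to agree.\<close>

lemma second_difference:
  fixes f :: "'a::euclidean_space \<Rightarrow> real"
  assumes "Ck_on 2 S f" and "cball x (h * (norm u + norm v)) \<subseteq> S" and "h > 0"
  obtains \<xi> where "\<xi> \<in> cball x (h * (norm u + norm v))"
    and "f (x + h *\<^sub>R u + h *\<^sub>R v) - f (x + h *\<^sub>R u) - f (x + h *\<^sub>R v) + f x =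
      h * h * frechet_derivative (\<lambda>y. frechet_derivative f (at y) u) (at \<xi>) v"
proof -
  let ?B = "cball x (h * (norm u + norm v))"
  let ?D = "\<lambda>y. frechet_derivative f (at y)"
  \<comment> \<open>The radius bounds \<open>s *\<^sub>R u + t *\<^sub>R v\<close> on the whole
    parallelogram, so both uses of the mean value theorem stay where \<open>f\<close> is twice
    differentiable.\<close>
  have inB: "x + s *\<^sub>R u + t *\<^sub>R v \<in> ?B" if "0 \<le> s" "s \<le> h" "0 \<le> t" "t \<le> h" for s t
  proof -
    have "norm (s *\<^sub>R u + t *\<^sub>R v) \<le> norm (s *\<^sub>R u) + norm (t *\<^sub>R v)" by (rule norm_triangle_ineq)
    also have "\<dots> \<le> h * norm u + h * norm v"
      using that by (auto intro!: add_mono mult_right_mono)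
    finally show ?thesis by (simp add: dist_norm norm_minus_commute distrib_left add.assoc
          flip: norm_minus_cancel[of "s *\<^sub>R u + t *\<^sub>R v"])
  qed
  have fd: "f differentiable (at y)" and fdd: "(\<lambda>y. ?D y u) differentiable (at y)" if "y \<in> ?B" for y
    using assms(1,2) that by (auto simp: numeral_2_eq_2)
  have *: "x + s *\<^sub>R u + t *\<^sub>R v = (x + t *\<^sub>R v) + s *\<^sub>R u" for s t by simp
  \<comment> \<open>The function of \<open>s\<close> is the increment of \<open>f\<close> over h v;
    its mean value is an increment of the derivative along \<open>u\<close> over the same h v, to
    which the theorem applies again.\<close>
  have "((\<lambda>s. f ((x + h *\<^sub>R v) + s *\<^sub>R u) - f (x + s *\<^sub>R u)) has_real_derivative
      ?D ((x + h *\<^sub>R v) + s *\<^sub>R u) u - ?D (x + s *\<^sub>R u) u) (at s)" if "0 \<le> s" "s \<le> h" for s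
    by (intro DERIV_diff has_real_derivative_along_line fd)
      (use inB[of s h] inB[of s 0] that assms(3) in \<open>simp_all add: *\<close>)
  from MVT2[OF assms(3) this] obtain z where z: "0 < z" "z < h"
    and eq1: "f ((x + h *\<^sub>R v) + h *\<^sub>R u) - f (x + h *\<^sub>R u) - (f (x + h *\<^sub>R v) - f x) =
      h * (?D ((x + h *\<^sub>R v) + z *\<^sub>R u) u - ?D (x + z *\<^sub>R u) u)"
    by auto
  have "((\<lambda>t. ?D ((x + z *\<^sub>R u) + t *\<^sub>R v) u) has_real_derivative
      frechet_derivative (\<lambda>y. ?D y u) (at ((x + z *\<^sub>R u) + t *\<^sub>R v)) v) (at t)"
    if "0 \<le> t" "t \<le> h" for t
    by (rule has_real_derivative_along_line[where g = "\<lambda>y. ?D y u"] , rule fdd) (use inB[of z t] that z in simp)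
  from MVT2[OF assms(3) this] obtain w where w: "0 < w" "w < h"
    and eq2: "?D ((x + z *\<^sub>R u) + h *\<^sub>R v) u - ?D (x + z *\<^sub>R u) u =
      h * frechet_derivative (\<lambda>y. ?D y u) (at ((x + z *\<^sub>R u) + w *\<^sub>R v)) v"
    by auto
  show thesis
  proof
    show "(x + z *\<^sub>R u) + w *\<^sub>R v \<in> ?B" using inB z w by simp
    show "f (x + h *\<^sub>R u + h *\<^sub>R v) - f (x + h *\<^sub>R u) - f (x + h *\<^sub>R v) + f x =
      h * h * frechet_derivative (\<lambda>y. ?D y u) (at ((x + z *\<^sub>R u) + w *\<^sub>R v)) v"
      using eq1 eq2 by (simp add: algebra_simps)
  qed
qed

text \<open>One and the same second difference equals h^2 times either mixed derivative at points
  near \<open>x\<close>. Both are continuous at \<open>x\<close>, so for small \<open>h\<close> they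
  cannot differ there.\<close>

lemma second_derivative_symmetric_real:
  fixes f :: "'a::euclidean_space \<Rightarrow> real"
  assumes "Ck_on 2 S f" and "open S" and "x \<in> S"
  shows "frechet_derivative (\<lambda>y. frechet_derivative f (at y) u) (at x) v =
    frechet_derivative (\<lambda>y. frechet_derivative f (at y) v) (at x) u"
proof (rule ccontr)
  define G where "G u v y = frechet_derivative (\<lambda>y. frechet_derivative f (at y) u) (at y) v" for u v y
  assume "\<not> ?thesis"
  then have ne: "G u v x \<noteq> G v u x" by (simp add: G_def)
  \<comment> \<open>Half the distance: the common value \<open>G u v \<xi> = G v u \<eta>\<close>
    will lie within \<open>\<epsilon>\<close> of two numbers that are \<open>2 * \<epsilon>\<close>
    apart.\<close>
  define \<epsilon> where "\<epsilon> = dist (G u v x) (G v u x) / 2"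
  have "\<epsilon> > 0" using ne by (simp add: \<epsilon>_def)
  have "continuous (at x) (G u v)" for u v
    using assms by (auto simp: numeral_2_eq_2 G_def[abs_def] continuous_on_eq_continuous_at)
  then have "\<exists>d>0. \<forall>y. dist y x < d \<longrightarrow> dist (G u v y) (G u v x) < \<epsilon>" for u v
    using \<open>\<epsilon> > 0\<close> unfolding continuous_at_eps_delta by blast
  then obtain d1 d2 where d: "d1 > 0" "\<And>y. dist y x < d1 \<Longrightarrow> dist (G u v y) (G u v x) < \<epsilon>"
    "d2 > 0" "\<And>y. dist y x < d2 \<Longrightarrow> dist (G v u y) (G v u x) < \<epsilon>"
    by meson
  obtain r where r: "r > 0" "ball x r \<subseteq> S" using assms(2,3) open_contains_ball by blast
  define m where "m = min r (min d1 d2)"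
  \<comment> \<open>The summand 1 keeps the denominator positive for u = v = 0 and makes the radius
    of the ball strictly smaller than \<open>m\<close>.\<close>
  define h where "h = m / (norm u + norm v + 1)"
  have "m > 0" using r d by (simp add: m_def)
  have "norm u + norm v + 1 > 0" by (smt (verit) norm_ge_zero)
  then have h: "h > 0" "h * (norm u + norm v) < m"
    using \<open>m > 0\<close> by (auto simp: h_def field_simps)
  then have near: "dist y x < m" if "y \<in> cball x (h * (norm u + norm v))" for y
    using that by (simp add: dist_commute)
  then have sub: "cball x (h * (norm u + norm v)) \<subseteq> S"
    using r by (auto simp: m_def dist_commute subset_iff)
  obtain \<xi> where \<xi>: "\<xi> \<in> cball x (h * (norm u + norm v))"
    "f (x + h *\<^sub>R u + h *\<^sub>R v) - f (x + h *\<^sub>R u) - f (x + h *\<^sub>R v) + f x = h * h * G u v \<xi>"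
    using second_difference[OF assms(1) sub h(1)] unfolding G_def by metis
  obtain \<eta> where \<eta>: "\<eta> \<in> cball x (h * (norm v + norm u))"
    "f (x + h *\<^sub>R v + h *\<^sub>R u) - f (x + h *\<^sub>R v) - f (x + h *\<^sub>R u) + f x = h * h * G v u \<eta>"
    using second_difference[OF assms(1) _ h(1), of x v u] sub unfolding G_def add.commute[of "norm u"] by metis
  have "h * h * G u v \<xi> = h * h * G v u \<eta>"
    using \<xi>(2) \<eta>(2) by (simp add: algebra_simps)
  then have "G u v \<xi> = G v u \<eta>" using h by simp
  moreover have "dist (G u v \<xi>) (G u v x) < \<epsilon>" "dist (G v u \<eta>) (G v u x) < \<epsilon>"
    using d near \<xi>(1) \<eta>(1) by (auto simp: m_def add.commute)
  ultimately show False unfolding \<epsilon>_def by (metis dist_triangle_half_l less_irrefl dist_commute)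
qed

text \<open>Taking components with respect to \<open>Basis\<close> commutes with differentiation,
  which reduces the claim to real values.\<close>

lemma second_derivative_symmetric:
  fixes f :: "'a::euclidean_space \<Rightarrow> 'b::euclidean_space"
  assumes f: "Ck_on 2 S f" and "open S" and "x \<in> S"
  shows "frechet_derivative (\<lambda>y. frechet_derivative f (at y) u) (at x) v =
    frechet_derivative (\<lambda>y. frechet_derivative f (at y) v) (at x) u"
proof (rule euclidean_eqI)
  fix b :: 'b assume "b \<in> Basis"
  have inner: "frechet_derivative (\<lambda>y. g y \<bullet> b) (at y) w = frechet_derivative g (at y) w \<bullet> b"
    if "g differentiable (at y)" for y w and g :: "'a \<Rightarrow> 'b"
  proof -
    have "((\<lambda>y. g y \<bullet> b) has_derivative (\<lambda>w. frechet_derivative g (at y) w \<bullet> b)) (at y)"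
      using that by (intro has_derivative_inner_left) (simp add: frechet_derivative_works)
    then show ?thesis by (simp flip: frechet_derivative_at)
  qed
  have fd: "f differentiable (at y)" "(\<lambda>y. frechet_derivative f (at y) w) differentiable (at y)"
    if "y \<in> S" for y w
    using f that by (auto simp: numeral_2_eq_2)
  have "frechet_derivative (\<lambda>y. frechet_derivative (\<lambda>y. f y \<bullet> b) (at y) w) (at x) z =
      frechet_derivative (\<lambda>y. frechet_derivative f (at y) w) (at x) z \<bullet> b" for w z
  proof -
    have "frechet_derivative (\<lambda>y. frechet_derivative f (at y) w \<bullet> b) (at x) =
        frechet_derivative (\<lambda>y. frechet_derivative (\<lambda>y. f y \<bullet> b) (at y) w) (at x)"
      by (rule frechet_derivative_transform_within_open[OF _ assms(2,3)])
        (use fd assms(3) in \<open>auto simp: inner intro!: differentiable_inner\<close>)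
    then show ?thesis using inner[OF fd(2)[OF assms(3)]] by metis
  qed
  moreover have "Ck_on 2 S (\<lambda>y. f y \<bullet> b)"
    using Ck_on_bounded_linear[OF assms(2) bounded_linear_inner_left f] .
  ultimately show "frechet_derivative (\<lambda>y. frechet_derivative f (at y) u) (at x) v \<bullet> b =
    frechet_derivative (\<lambda>y. frechet_derivative f (at y) v) (at x) u \<bullet> b"
    using second_derivative_symmetric_real[OF _ assms(2,3)] by metis
qed


section \<open>Pullback and exterior derivative on Euclidean spaces\<close>

text \<open>Coordinate counterpart of \<open>alternating_multilinear\<close>. The arguments fill a
  whole vector space, so each slot is \<open>linear\<close> in the library sense, and lists are
  split at the slot instead of updated at an index, which suits moving arguments past one
  another.\<close>

definition alt_form :: "nat \<Rightarrow> ('e::real_vector list \<Rightarrow> real) \<Rightarrow> bool" where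
  "alt_form k w \<longleftrightarrow>
     (\<forall>us vs. length us + Suc (length vs) = k \<longrightarrow> linear (\<lambda>x. w (us @ x # vs))) \<and>
     (\<forall>us vs ws x. length us + length vs + length ws + 2 = k \<longrightarrow> w (us @ x # vs @ x # ws) = 0)"

lemma alt_form_linear:
  "alt_form k w \<Longrightarrow> length us + Suc (length vs) = k \<Longrightarrow> linear (\<lambda>x. w (us @ x # vs))"
  by (simp add: alt_form_def)

text \<open>Polarization: expand the value with \<open>x + y\<close> in both slots, which is
  zero.\<close>

lemma alt_form_swap:
  assumes w: "alt_form k w" and k: "length us + length vs + 2 = k"
  shows "w (us @ x # y # vs) = - w (us @ y # x # vs)"
proof -
  have l1: "w (us @ (x + y) # z # vs) = w (us @ x # z # vs) + w (us @ y # z # vs)" for z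
    using linear_add[OF alt_form_linear[OF w, of us "z # vs"]] k by simp
  have l2: "w (us @ z # (x + y) # vs) = w (us @ z # x # vs) + w (us @ z # y # vs)" for z
    using linear_add[OF alt_form_linear[OF w, of "us @ [z]" vs]] k by simp
  have 0: "w (us @ z # z # vs) = 0" for z
    using w k unfolding alt_form_def by (metis append_Nil list.size(3) add_0_right)
  show ?thesis using 0[of "x + y"] 0[of x] 0[of y] l1 l2 by simp
qed

text \<open>Each step swaps \<open>x\<close> with the head of \<open>vs\<close> and hands that head
  over to \<open>us\<close>, which is why \<open>us\<close> is generalized.\<close>

lemma alt_form_move:
  assumes w: "alt_form k w"
  shows "length us + length vs + length ws + 1 = k \<Longrightarrow>
    w (us @ x # vs @ ws) = (-1) ^ length vs * w (us @ vs @ x # ws)"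
proof (induction vs arbitrary: us)
  case Nil
  then show ?case by simp
next
  case (Cons v vs)
  have "w (us @ x # v # vs @ ws) = - w (us @ v # x # vs @ ws)"
    by (rule alt_form_swap[OF w]) (use Cons.prems in simp)
  then show ?case using Cons.IH[of "us @ [v]"] Cons.prems by simp
qed

text \<open>Here i is the position of a deleted list entry and l an index into the shortened list,
  so l < i names the original position l and l \<ge> i the position l + 1. Two distinct original
  positions l < i thus occur twice, as (i, l) and as (l, i - 1), and these two terms cancel.\<close>

lemma double_sum_antisym:
  fixes g :: "nat \<Rightarrow> nat \<Rightarrow> real"
  assumes "\<And>i l. l < i \<Longrightarrow> i \<le> k \<Longrightarrow> g i l = - g l (i - 1)"
  shows "(\<Sum>i<Suc k. \<Sum>l<k. g i l) = 0"
proof -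
  let ?L = "SIGMA i:{..<Suc k}. {l. l < i}" and ?U = "SIGMA i:{..<Suc k}. {l. i \<le> l \<and> l < k}"
  have "(\<Sum>i<Suc k. \<Sum>l<k. g i l) = (\<Sum>(i, l)\<in>(SIGMA i:{..<Suc k}. {..<k}). g i l)"
    by (rule sum.Sigma) auto
  also have "(SIGMA i:{..<Suc k}. {..<k}) = ?L \<union> ?U" by auto
  also have "(\<Sum>(i, l)\<in>?L \<union> ?U. g i l) = (\<Sum>(i, l)\<in>?L. g i l) + (\<Sum>(i, l)\<in>?U. g i l)"
    by (rule sum.union_disjoint) auto
  also have "(\<Sum>(i, l)\<in>?U. g i l) = (\<Sum>(i, l)\<in>?L. g l (i - 1))"
    by (rule sum.reindex_bij_witness[of _ "\<lambda>(i, l). (l, i - 1)" "\<lambda>(i, l). (Suc l, i)"]) auto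
  also have "(\<Sum>(i, l)\<in>?L. g i l) = (\<Sum>(i, l)\<in>?L. - g l (i - 1))"
    by (rule sum.cong) (use assms in auto)
  finally show ?thesis by (simp add: sum_negf split_def)
qed

text \<open>These are the terms with second derivatives in d of a pullback, \<open>D\<close> being
  the first and \<open>s\<close> the second derivative. For entries p before q, either one is
  deleted and merged into the other as \<open>s q p\<close> or \<open>s p q\<close>; moving the
  merged vector across the entries in between contributes the sign that makes the two terms
  opposite.\<close>

lemma alt_form_symmetric_cancel:
  fixes D :: "'a \<Rightarrow> 'e::real_vector"
  assumes w: "alt_form k w" and s: "\<And>u v. s u v = s v u" and len: "length us = Suc k"
  shows "(\<Sum>i<Suc k. (-1) ^ i *
    (\<Sum>l<k. w ((map D (take i us @ drop (Suc i) us))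
      [l := s (us ! i) ((take i us @ drop (Suc i) us) ! l)]))) = 0"
proof -
  define W where "W i = take i us @ drop (Suc i) us" for i
  define g where "g i l = (-1) ^ i * w ((map D (W i))[l := s (us ! i) (W i ! l)])" for i l
  have "g i l = - g l (i - 1)" if "l < i" "i \<le> k" for i l
  proof -
    define P p M q Q where "P = take l us" and "p = us ! l" and "M = drop (Suc l) (take i us)"
      and "q = us ! i" and "Q = drop (Suc i) us"
    have "us = take i us @ q # Q" using that len by (simp add: q_def Q_def id_take_nth_drop)
    moreover have "take i us = P @ p # M"
      using that len id_take_nth_drop[of l "take i us"] by (simp add: P_def p_def M_def min_def)
    ultimately have us: "us = P @ p # M @ q # Q" by simp
    have lP: "length P = l" and lM: "length M = i - l - 1" and lQ: "length Q = k - i"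
      using that len by (auto simp: P_def M_def Q_def)
    have i: "i = l + Suc (length M)" using lM that by simp
    \<comment> \<open>Deleting \<open>p\<close> shifts \<open>q\<close> from position
      \<open>i\<close> to \<open>i - 1\<close>, which is the length of \<open>P @ M\<close>.\<close>
    have "W i = P @ p # M @ Q" "us ! i = q" and "W l = P @ M @ q # Q" "us ! l = p"
      using lP unfolding W_def i us by (simp_all add: nth_append)
    moreover have "i - 1 = length P + length M" "l = length P" using lP i by simp_all
    ultimately have "g i l = (-1) ^ i * w (map D P @ s q p # map D M @ map D Q)"
      "g l (i - 1) = (-1) ^ l * w (map D P @ map D M @ s p q # map D Q)"
      unfolding g_def by (simp_all add: list_update_append nth_append)
    moreover have "w (map D P @ s q p # map D M @ map D Q) =
        (-1) ^ length M * w (map D P @ map D M @ s q p # map D Q)"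
      using alt_form_move[OF w, of "map D P" "map D M" "map D Q"] lP lM lQ that by simp
    \<comment> \<open>The outer signs differ by l + 1 plus the length of \<open>M\<close> against l,
      the move supplies the length of \<open>M\<close>, and one factor -1 remains.\<close>
    ultimately show ?thesis unfolding i s[of q p] by (simp add: power_add)
  qed
  from double_sum_antisym[of k g, OF this] show ?thesis
    unfolding g_def W_def by (simp add: sum_distrib_left)
qed

section \<open>Forms evaluated on arguments that vary with the point\<close>

lemma alt_form_expand:
  fixes w :: "'e::euclidean_space list \<Rightarrow> real"
  assumes "alt_form k w" "length us + Suc (length vs) = k"
  shows "w (us @ x # vs) = (\<Sum>b\<in>Basis. (x \<bullet> b) * w (us @ b # vs))"
  by (rule linear_sum_Basis[OF alt_form_linear[OF assms], unfolded real_scaleR_def])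

text \<open>The varying arguments \<open>gs\<close> stand before the constant ones
  \<open>us\<close>. Induction from the end of \<open>gs\<close> expands the last varying argument
  in \<open>Basis\<close> and so turns it into a constant at the front of \<open>us\<close>, until
  only the assumption on constant arguments is left.\<close>

lemma smooth_on_alt_form:
  fixes F :: "'a::euclidean_space \<Rightarrow> 'b::euclidean_space"
    and \<omega> :: "'b \<Rightarrow> 'e::euclidean_space list \<Rightarrow> real"
  assumes S: "open S" and FT: "F ` S \<subseteq> T" and F: "smooth_on S F"
    and alt: "\<And>y. y \<in> T \<Longrightarrow> alt_form k (\<omega> y)"
    and \<omega>: "\<And>ws. length ws = k \<Longrightarrow> smooth_on T (\<lambda>y. \<omega> y ws)"
  shows "\<lbrakk>\<And>g. g \<in> set gs \<Longrightarrow> smooth_on S g; length gs + length us = k\<rbrakk>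
    \<Longrightarrow> smooth_on S (\<lambda>x. \<omega> (F x) (map (\<lambda>g. g x) gs @ us))"
proof (induction gs arbitrary: us rule: rev_induct)
  case Nil
  then show ?case using smooth_on_compose[OF S FT F \<omega>[of us]] by (simp add: o_def)
next
  case (snoc g gs)
  have "smooth_on S (\<lambda>x. \<Sum>b\<in>Basis. (g x \<bullet> b) *\<^sub>R \<omega> (F x) (map (\<lambda>g. g x) gs @ b # us))"
  proof (intro smooth_on_sum smooth_on_scaleR S finite_Basis)
    fix b :: 'e
    have "smooth_on S g" by (rule snoc.prems(1)) simp
    then show "smooth_on S (\<lambda>x. g x \<bullet> b)"
      by (rule smooth_on_bounded_linear[OF S bounded_linear_inner_left])
    have "smooth_on S g'" if "g' \<in> set gs" for g'
      by (rule snoc.prems(1)) (use that in simp)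
    then show "smooth_on S (\<lambda>x. \<omega> (F x) (map (\<lambda>g. g x) gs @ b # us))"
      by (rule snoc.IH) (use snoc.prems(2) in simp_all)
  qed
  moreover have "\<omega> (F x) (map (\<lambda>g. g x) (gs @ [g]) @ us) =
      (\<Sum>b\<in>Basis. (g x \<bullet> b) *\<^sub>R \<omega> (F x) (map (\<lambda>g. g x) gs @ b # us))" if "x \<in> S" for x
  proof -
    have "F x \<in> T" using that FT by blast
    from alt_form_expand[OF alt[OF this], of "map (\<lambda>g. g x) gs" us "g x"] snoc.prems(2)
    show ?thesis by simp
  qed
  ultimately show ?case by (rule smooth_on_cong[OF S, THEN iffD2, rotated])
qed

text \<open>Linearity in a slot survives differentiation in the base point, because the expansion
  holds on a whole neighbourhood of \<open>y\<close>. It serves to reassemble sums over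
  \<open>Basis\<close> after the product rule.\<close>

lemma frechet_derivative_alt_form_expand:
  fixes \<omega> :: "'b::euclidean_space \<Rightarrow> 'e::euclidean_space list \<Rightarrow> real"
  assumes T: "open T" and y: "y \<in> T"
    and alt: "\<And>y. y \<in> T \<Longrightarrow> alt_form k (\<omega> y)"
    and \<omega>: "\<And>ws. length ws = k \<Longrightarrow> (\<lambda>y. \<omega> y ws) differentiable (at y)"
    and k: "length us + Suc (length vs) = k"
  shows "frechet_derivative (\<lambda>y. \<omega> y (us @ x # vs)) (at y) h =
    (\<Sum>b\<in>Basis. (x \<bullet> b) * frechet_derivative (\<lambda>y. \<omega> y (us @ b # vs)) (at y) h)"
proof -
  have "((\<lambda>y. \<Sum>b\<in>Basis. (x \<bullet> b) * \<omega> y (us @ b # vs)) has_derivative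
      (\<lambda>h. \<Sum>b\<in>Basis. (x \<bullet> b) * frechet_derivative (\<lambda>y. \<omega> y (us @ b # vs)) (at y) h)) (at y)"
    by (intro has_derivative_sum has_derivative_mult_right)
      (use \<omega> k in \<open>simp flip: frechet_derivative_works\<close>)
  then have "((\<lambda>y. \<omega> y (us @ x # vs)) has_derivative
      (\<lambda>h. \<Sum>b\<in>Basis. (x \<bullet> b) * frechet_derivative (\<lambda>y. \<omega> y (us @ b # vs)) (at y) h)) (at y)"
    by (rule has_derivative_transform_within_open[OF _ T y])
      (simp add: alt_form_expand[OF alt k])
  then show ?thesis by (simp flip: frechet_derivative_at)
qed

text \<open>Product rule: one term for the moving base point and one for each moving argument. The
  induction is that of \<open>smooth_on_alt_form\<close>, with the last argument written out in
  \<open>Basis\<close>.\<close>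

lemma has_derivative_alt_form:
  fixes F :: "'a::euclidean_space \<Rightarrow> 'b::euclidean_space"
    and \<omega> :: "'b \<Rightarrow> 'e::euclidean_space list \<Rightarrow> real"
  assumes S: "open S" "x \<in> S" and T: "open T" "F ` S \<subseteq> T" and F: "F differentiable (at x)"
    and alt: "\<And>y. y \<in> T \<Longrightarrow> alt_form k (\<omega> y)"
    and \<omega>: "\<And>y ws. y \<in> T \<Longrightarrow> length ws = k \<Longrightarrow> (\<lambda>y. \<omega> y ws) differentiable (at y)"
  shows "\<lbrakk>\<And>g. g \<in> set gs \<Longrightarrow> g differentiable (at x); length gs + length us = k\<rbrakk>
    \<Longrightarrow> ((\<lambda>z. \<omega> (F z) (map (\<lambda>g. g z) gs @ us)) has_derivative
      (\<lambda>h. frechet_derivative (\<lambda>y. \<omega> y (map (\<lambda>g. g x) gs @ us)) (at (F x))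
          (frechet_derivative F (at x) h) +
        (\<Sum>l<length gs. \<omega> (F x)
          ((map (\<lambda>g. g x) gs)[l := frechet_derivative (gs ! l) (at x) h] @ us)))) (at x)"
proof (induction gs arbitrary: us rule: rev_induct)
  case Nil
  have "(F has_derivative frechet_derivative F (at x)) (at x)"
    using F by (simp add: frechet_derivative_works)
  moreover have "((\<lambda>y. \<omega> y us) has_derivative frechet_derivative (\<lambda>y. \<omega> y us) (at (F x))) (at (F x))"
    using \<omega>[of "F x" us] S T Nil by (auto simp: frechet_derivative_works)
  ultimately show ?case using has_derivative_compose by simp blast
next
  case (snoc g gs)
  let ?V = "map (\<lambda>g. g x) gs" and ?DF = "frechet_derivative F (at x)"
    and ?Dg = "frechet_derivative g (at x)"
  have Fx: "F x \<in> T" using S T by auto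
  let ?U = "\<lambda>l h. ?V[l := frechet_derivative (gs ! l) (at x) h]"
  let ?H = "\<lambda>b h. frechet_derivative (\<lambda>y. \<omega> y (?V @ b # us)) (at (F x)) (?DF h) +
        (\<Sum>l<length gs. \<omega> (F x) (?U l h @ b # us))"
  have k: "length ?V + Suc (length us) = k" "length (?U l h) + Suc (length us) = k" for l h
    using snoc.prems by simp_all
  have IH: "((\<lambda>z. \<omega> (F z) (map (\<lambda>g. g z) gs @ b # us)) has_derivative ?H b) (at x)" for b
    using snoc by simp
  have "((\<lambda>z. g z \<bullet> b) has_derivative (\<lambda>h. ?Dg h \<bullet> b)) (at x)" for b
    by (intro has_derivative_inner_left) (use snoc.prems in \<open>simp flip: frechet_derivative_works\<close>)
  then have "((\<lambda>z. \<Sum>b\<in>Basis. (g z \<bullet> b) * \<omega> (F z) (map (\<lambda>g. g z) gs @ b # us)) has_derivative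
      (\<lambda>h. \<Sum>b\<in>Basis. (g x \<bullet> b) * ?H b h + (?Dg h \<bullet> b) * \<omega> (F x) (?V @ b # us))) (at x)"
    by (intro has_derivative_sum has_derivative_mult IH)
  then have "((\<lambda>z. \<omega> (F z) (map (\<lambda>g. g z) (gs @ [g]) @ us)) has_derivative
      (\<lambda>h. \<Sum>b\<in>Basis. (g x \<bullet> b) * ?H b h + (?Dg h \<bullet> b) * \<omega> (F x) (?V @ b # us))) (at x)"
  proof (rule has_derivative_transform_within_open[OF _ S])
    fix z assume "z \<in> S"
    then have "F z \<in> T" using T by auto
    from alt_form_expand[OF alt[OF this], of "map (\<lambda>g. g z) gs" us "g z"] snoc.prems
    show "(\<Sum>b\<in>Basis. (g z \<bullet> b) * \<omega> (F z) (map (\<lambda>g. g z) gs @ b # us)) =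
      \<omega> (F z) (map (\<lambda>g. g z) (gs @ [g]) @ us)" by simp
  qed
  moreover have "(\<Sum>b\<in>Basis. (g x \<bullet> b) * ?H b h + (?Dg h \<bullet> b) * \<omega> (F x) (?V @ b # us)) =
      frechet_derivative (\<lambda>y. \<omega> y (map (\<lambda>g. g x) (gs @ [g]) @ us)) (at (F x)) (?DF h) +
        (\<Sum>l<length (gs @ [g]). \<omega> (F x)
          ((map (\<lambda>g. g x) (gs @ [g]))[l := frechet_derivative ((gs @ [g]) ! l) (at x) h] @ us))"
    (is "?l = ?r") for h
  proof -
    \<comment> \<open>The three sums over \<open>Basis\<close> reassemble into the base point term,
      the terms of the earlier arguments, and the new term in which the last argument is
      differentiated.\<close>
    have "?l = (\<Sum>b\<in>Basis. (g x \<bullet> b) * frechet_derivative (\<lambda>y. \<omega> y (?V @ b # us)) (at (F x)) (?DF h))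
        + (\<Sum>l<length gs. \<Sum>b\<in>Basis. (g x \<bullet> b) * \<omega> (F x) (?U l h @ b # us))
        + (\<Sum>b\<in>Basis. (?Dg h \<bullet> b) * \<omega> (F x) (?V @ b # us))"
      by (subst sum.swap) (simp add: distrib_left sum.distrib sum_distrib_left)
    also have "\<dots> = frechet_derivative (\<lambda>y. \<omega> y (?V @ g x # us)) (at (F x)) (?DF h)
        + (\<Sum>l<length gs. \<omega> (F x) (?U l h @ g x # us)) + \<omega> (F x) (?V @ ?Dg h # us)"
      using alt_form_expand[OF alt[OF Fx] k(1), where x = "?Dg h"]
        alt_form_expand[OF alt[OF Fx] k(2), where x = "g x"]
        frechet_derivative_alt_form_expand[OF T(1) Fx alt \<omega>[OF Fx] k(1), where x = "g x" and h = "?DF h"]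
      by simp
    also have "\<dots> = ?r"
      by (simp add: list_update_append nth_append)
    finally show ?thesis .
  qed
  ultimately show ?case by simp
qed

text \<open>\<open>has_derivative_alt_form\<close> is applied to the arguments z -> DF_z(v). The
  base point terms make up the right-hand side, and the argument terms are exactly the double sum of
  \<open>alt_form_symmetric_cancel\<close>.\<close>

lemma euclidean_ext_deriv_pullback:
  fixes F :: "'a::euclidean_space \<Rightarrow> 'b::euclidean_space"
    and \<omega> :: "'b \<Rightarrow> 'b list \<Rightarrow> real"
  assumes S: "open S" "x \<in> S" and T: "open T" "F ` S \<subseteq> T" and F: "smooth_on S F"
    and alt: "\<And>y. y \<in> T \<Longrightarrow> alt_form k (\<omega> y)"
    and \<omega>: "\<And>ws. length ws = k \<Longrightarrow> smooth_on T (\<lambda>y. \<omega> y ws)"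
    and len: "length us = Suc k"
  shows "euclidean_ext_deriv (\<lambda>z vs. \<omega> (F z) (map (frechet_derivative F (at z)) vs)) x us =
    euclidean_ext_deriv \<omega> (F x) (map (frechet_derivative F (at x)) us)"
proof -
  define D where "D = frechet_derivative F (at x)"
  \<comment> \<open>\<open>u\<close> is the direction of differentiation and \<open>v\<close> the
    vector fed into DF; exchanging these roles is where smoothness of \<open>F\<close> to second
    order enters.\<close>
  define s where "s u v = frechet_derivative (\<lambda>z. frechet_derivative F (at z) v) (at x) u" for u v
  define W where "W i = take i us @ drop (Suc i) us" for i
  have sym: "s u v = s v u" for u v
    unfolding s_def by (rule second_derivative_symmetric[OF smooth_on_imp_Ck_on[OF F] S])
  have W: "length (W i) = k" if "i < Suc k" for i using that len by (simp add: W_def)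
  have "frechet_derivative (\<lambda>z. \<omega> (F z) (map (frechet_derivative F (at z)) (W i))) (at x) (us ! i) =
      frechet_derivative (\<lambda>y. \<omega> y (map D (W i))) (at (F x)) (D (us ! i)) +
      (\<Sum>l<k. \<omega> (F x) ((map D (W i))[l := s (us ! i) (W i ! l)]))" if "i < Suc k" for i
  proof -
    let ?gs = "map (\<lambda>v z. frechet_derivative F (at z) v) (W i)"
    have gs: "map (\<lambda>g. g z) ?gs = map (frechet_derivative F (at z)) (W i)" for z by simp
    have "((\<lambda>z. \<omega> (F z) (map (\<lambda>g. g z) ?gs @ [])) has_derivative
      (\<lambda>h. frechet_derivative (\<lambda>y. \<omega> y (map (\<lambda>g. g x) ?gs @ [])) (at (F x))
          (frechet_derivative F (at x) h) +
        (\<Sum>l<length ?gs. \<omega> (F x)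
          ((map (\<lambda>g. g x) ?gs)[l := frechet_derivative (?gs ! l) (at x) h] @ [])))) (at x)"
    proof (rule has_derivative_alt_form[OF S T])
      show "F differentiable (at x)" using smooth_on_differentiable[OF F S(2)] .
      show "g differentiable (at x)" if "g \<in> set ?gs" for g
        using that smooth_on_differentiable[OF smooth_on_frechet_derivative[OF F] S(2)] by auto
      show "length ?gs + length [] = k" using W[OF that] by simp
      show "(\<lambda>y. \<omega> y ws) differentiable (at y)" if "y \<in> T" "length ws = k" for y ws
        using smooth_on_differentiable[OF \<omega>] that by blast
    qed (rule alt)
    then have "((\<lambda>z. \<omega> (F z) (map (frechet_derivative F (at z)) (W i))) has_derivative
      (\<lambda>h. frechet_derivative (\<lambda>y. \<omega> y (map D (W i))) (at (F x)) (D h) +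
        (\<Sum>l<k. \<omega> (F x) ((map D (W i))[l := s h (W i ! l)])))) (at x)"
      unfolding gs append_Nil2 D_def s_def using W[OF that] by simp
    then show ?thesis by (simp flip: frechet_derivative_at)
  qed
  then have "euclidean_ext_deriv (\<lambda>z vs. \<omega> (F z) (map (frechet_derivative F (at z)) vs)) x us =
      (\<Sum>i<Suc k. (-1) ^ i * frechet_derivative (\<lambda>y. \<omega> y (map D (W i))) (at (F x)) (D (us ! i))) +
      (\<Sum>i<Suc k. (-1) ^ i * (\<Sum>l<k. \<omega> (F x) ((map D (W i))[l := s (us ! i) (W i ! l)])))"
    unfolding euclidean_ext_deriv_def len W_def[symmetric] by (simp add: distrib_left sum.distrib)
  also have "(\<Sum>i<Suc k. (-1) ^ i * (\<Sum>l<k. \<omega> (F x) ((map D (W i))[l := s (us ! i) (W i ! l)]))) = 0"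
    unfolding W_def using S T by (intro alt_form_symmetric_cancel[OF alt sym len]) auto
  finally show ?thesis
    unfolding euclidean_ext_deriv_def by (simp add: len D_def W_def take_map drop_map)
qed


section \<open>Tangent maps in coordinates\<close>

lemma smooth_atlas_is_chart: "smooth_atlas A \<Longrightarrow> c \<in> A \<Longrightarrow> is_chart c"
  by (simp add: smooth_atlas_def)

lemma chart_inv_chart_map: "is_chart c \<Longrightarrow> p \<in> chart_dom c \<Longrightarrow> chart_inv c (chart_map c p) = p"
  unfolding is_chart_def by (meson homeomorphism_apply1)

lemma open_chart_image:
  assumes c: "is_chart c" and U: "open U"
  shows "open (chart_map c ` (chart_dom c \<inter> U))"
proof -
  have hom: "homeomorphism (chart_dom c) (chart_map c ` chart_dom c) (chart_map c) (chart_inv c)"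
    and op: "open (chart_map c ` chart_dom c)" using c by (auto simp: is_chart_def)
  have "openin (top_of_set (chart_map c ` chart_dom c)) (chart_map c ` (chart_dom c \<inter> U))"
    using homeomorphism_imp_open_map[OF hom openin_open_Int[OF U]] .
  then show ?thesis using openin_open_trans op by blast
qed

lemma chart_at:
  assumes "smooth_atlas A"
  shows "chart_at A p \<in> A" and "p \<in> chart_dom (chart_at A p)"
proof -
  have "\<exists>c. c \<in> A \<and> p \<in> chart_dom c" using assms unfolding smooth_atlas_def by blast
  from someI_ex[OF this] show "chart_at A p \<in> A" "p \<in> chart_dom (chart_at A p)"
    by (auto simp: chart_at_def)
qed

definition coord_rep ::
  "('m, 'e) chart \<Rightarrow> ('n, 'f) chart \<Rightarrow> ('m \<Rightarrow> 'n) \<Rightarrow> 'e \<Rightarrow> 'f" where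
  "coord_rep c d f = chart_map d \<circ> f \<circ> chart_inv c"

definition coord_deriv ::
  "('m, 'e::euclidean_space) chart \<Rightarrow> ('n, 'f::euclidean_space) chart \<Rightarrow> ('m \<Rightarrow> 'n) \<Rightarrow> 'm \<Rightarrow> 'e \<Rightarrow> 'f"
where
  "coord_deriv c d f p = frechet_derivative (coord_rep c d f) (at (chart_map c p))"

text \<open>Puts the transformation law of tangent vectors under the same chain rule as tangent
  maps.\<close>

lemma transition_eq_coord_rep: "transition c d = coord_rep c d id"
  by (simp add: transition_def coord_rep_def)

lemma smooth_map_id: "smooth_atlas A \<Longrightarrow> smooth_map A A id"
  by (simp add: smooth_atlas_def smooth_map_def transition_eq_coord_rep coord_rep_def id_def)

lemma smooth_map_vimage_open:
  "smooth_map A B f \<Longrightarrow> open U \<Longrightarrow> open (f -` U)"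
  by (simp add: smooth_map_def continuous_on_open_vimage)

lemma smooth_on_coord_rep:
  "smooth_map A B f \<Longrightarrow> c \<in> A \<Longrightarrow> d \<in> B \<Longrightarrow>
    smooth_on (chart_map c ` (chart_dom c \<inter> f -` chart_dom d)) (coord_rep c d f)"
  by (simp add: smooth_map_def coord_rep_def)

lemma coord_rep_differentiable:
  assumes "smooth_map A B f" "c \<in> A" "d \<in> B" "p \<in> chart_dom c" "f p \<in> chart_dom d"
  shows "coord_rep c d f differentiable (at (chart_map c p))"
  by (rule smooth_on_differentiable[OF smooth_on_coord_rep[OF assms(1-3)]]) (use assms in simp)

lemma linear_coord_deriv:
  assumes "smooth_map A B f" "c \<in> A" "d \<in> B" "p \<in> chart_dom c" "f p \<in> chart_dom d"
  shows "linear (coord_deriv c d f p)"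
  unfolding coord_deriv_def by (rule linear_frechet_derivative coord_rep_differentiable assms)+

lemma coord_rep_chart_map:
  "is_chart c \<Longrightarrow> p \<in> chart_dom c \<Longrightarrow> coord_rep c d f (chart_map c p) = chart_map d (f p)"
  by (simp add: coord_rep_def chart_inv_chart_map)

lemma open_coord_dom:
  assumes "smooth_atlas A" "smooth_atlas B" "smooth_map A B f" "c \<in> A" "d \<in> B"
  shows "open (chart_map c ` (chart_dom c \<inter> f -` chart_dom d))"
  using assms smooth_atlas_is_chart[of B d] smooth_atlas_is_chart[of A c]
  by (auto intro!: open_chart_image smooth_map_vimage_open[of A B] simp: is_chart_def)

text \<open>The coordinate expression of g \<circ> f factors through the chart \<open>d\<close> only
  where \<open>f\<close> lands in its domain. This is an open set around the point, which is enough
  for the derivative.\<close>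

lemma coord_deriv_comp:
  assumes A: "smooth_atlas A" and B: "smooth_atlas B"
    and f: "smooth_map A B f" and g: "smooth_map B C g"
    and c: "c \<in> A" "p \<in> chart_dom c" and d: "d \<in> B" "f p \<in> chart_dom d"
    and e: "e \<in> C" "g (f p) \<in> chart_dom e"
  shows "coord_deriv c e (g \<circ> f) p u = coord_deriv d e g (f p) (coord_deriv c d f p u)"
proof -
  let ?S = "chart_map c ` (chart_dom c \<inter> f -` chart_dom d)"
  have cc: "is_chart c" and dd: "is_chart d" using A B c d smooth_atlas_is_chart by blast+
  have 1: "coord_rep c d f differentiable (at (chart_map c p))"
    by (rule coord_rep_differentiable[OF f c(1) d(1) c(2) d(2)])
  have 2: "coord_rep d e g differentiable (at (coord_rep c d f (chart_map c p)))"
    using coord_rep_differentiable[OF g d(1) e(1) d(2) e(2)] coord_rep_chart_map[OF cc c(2), of d f]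
    by simp
  have eq: "frechet_derivative (coord_rep d e g \<circ> coord_rep c d f) (at (chart_map c p)) =
      frechet_derivative (coord_rep c e (g \<circ> f)) (at (chart_map c p))"
  proof (rule frechet_derivative_transform_within_open)
    show "coord_rep d e g \<circ> coord_rep c d f differentiable at (chart_map c p)"
      using 1 2 by (rule differentiable_chain_at)
    show "open ?S" by (rule open_coord_dom[OF A B f c(1) d(1)])
    show "chart_map c p \<in> ?S" using c d by simp
    show "(coord_rep d e g \<circ> coord_rep c d f) x = coord_rep c e (g \<circ> f) x" if "x \<in> ?S" for x
      using that cc dd by (auto simp: coord_rep_def chart_inv_chart_map)
  qed
  show ?thesis
    unfolding coord_deriv_def eq[symmetric] frechet_derivative_compose[OF 1 2]
    by (simp add: coord_rep_chart_map[OF cc c(2)])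
qed

lemma coord_deriv_id:
  assumes A: "smooth_atlas A" and c: "c \<in> A" "p \<in> chart_dom c"
  shows "coord_deriv c c id p u = u"
proof -
  let ?S = "chart_map c ` (chart_dom c \<inter> UNIV)"
  have cc: "is_chart c" using A c smooth_atlas_is_chart by blast
  have eq: "frechet_derivative (\<lambda>x. x) (at (chart_map c p)) =
    frechet_derivative (coord_rep c c id) (at (chart_map c p))"
    by (rule frechet_derivative_transform_within_open[OF _ open_chart_image[OF cc open_UNIV]])
      (use c cc in \<open>auto simp: coord_rep_def chart_inv_chart_map\<close>)
  show ?thesis unfolding coord_deriv_def eq[symmetric] by simp
qed

text \<open>The cocycle law of the transition derivatives, by which \<open>tangent_of_coords\<close>
  obeys the transformation law.\<close>

lemma coord_deriv_trans:
  assumes A: "smooth_atlas A" and "c \<in> A" "p \<in> chart_dom c" "d \<in> A" "p \<in> chart_dom d"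
    "e \<in> A" "p \<in> chart_dom e"
  shows "coord_deriv d e id p (coord_deriv c d id p u) = coord_deriv c e id p u"
  using coord_deriv_comp[OF A A smooth_map_id[OF A] smooth_map_id[OF A], of c p d e u] assms by simp

lemma mem_tangent_space:
  "v \<in> tangent_space A p \<longleftrightarrow>
     (\<forall>c\<in>A. \<forall>d\<in>A. p \<in> chart_dom c \<longrightarrow> p \<in> chart_dom d \<longrightarrow> v d = coord_deriv c d id p (v c)) \<and>
     (\<forall>c. \<not> (c \<in> A \<and> p \<in> chart_dom c) \<longrightarrow> v c = 0)"
  by (simp add: tangent_space_def coord_deriv_def transition_eq_coord_rep)

lemma tangent_of_coords_apply:
  "tangent_of_coords A c p u d =
    (if d \<in> A \<and> p \<in> chart_dom d then coord_deriv c d id p u else 0)"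
  by (simp add: tangent_of_coords_def coord_deriv_def transition_eq_coord_rep)

text \<open>The transformation law carries the coordinates from \<open>c\<close> to every other
  chart around \<open>p\<close>, and on the remaining charts both vectors are zero by
  convention.\<close>

lemma tangent_space_eqI:
  assumes "v \<in> tangent_space A p" "w \<in> tangent_space A p" "c \<in> A" "p \<in> chart_dom c" "v c = w c"
  shows "v = w"
proof
  fix d show "v d = w d" using assms unfolding mem_tangent_space by (metis (no_types, lifting))
qed

lemma tangent_of_coords_in_tangent_space:
  assumes "smooth_atlas A" "c \<in> A" "p \<in> chart_dom c"
  shows "tangent_of_coords A c p u \<in> tangent_space A p"
  using assms by (auto simp: mem_tangent_space tangent_of_coords_apply coord_deriv_trans)

lemma tangent_of_coords_self:
  assumes "smooth_atlas A" "c \<in> A" "p \<in> chart_dom c"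
  shows "tangent_of_coords A c p u c = u"
  using assms by (simp add: tangent_of_coords_apply coord_deriv_id)

lemma tangent_of_coords_linear:
  assumes "smooth_atlas A" "c \<in> A" "p \<in> chart_dom c"
  shows "tangent_of_coords A c p (a *\<^sub>R u + b *\<^sub>R v) =
    (\<lambda>d. a *\<^sub>R tangent_of_coords A c p u d + b *\<^sub>R tangent_of_coords A c p v d)"
proof
  fix d
  show "tangent_of_coords A c p (a *\<^sub>R u + b *\<^sub>R v) d =
    a *\<^sub>R tangent_of_coords A c p u d + b *\<^sub>R tangent_of_coords A c p v d"
    using linear_coord_deriv[OF smooth_map_id[OF assms(1)] assms(2), of d p] assms(3)
    by (auto simp: tangent_of_coords_apply linear_add linear_cmul)
qed

text \<open>Frees \<open>tangent_map\<close> from the chart chosen in its definition: the chain rule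
  absorbs the transition from \<open>c\<close> to that chart.\<close>

lemma tangent_map_apply:
  assumes A: "smooth_atlas A" and f: "smooth_map A B f" and v: "v \<in> tangent_space A p"
    and c: "c \<in> A" "p \<in> chart_dom c" and d: "d \<in> B" "f p \<in> chart_dom d"
  shows "tangent_map A B f p v d = coord_deriv c d f p (v c)"
proof -
  let ?c = "chart_at A p"
  note ch = chart_at[OF A, of p]
  have "tangent_map A B f p v d = coord_deriv ?c d f p (v ?c)"
    using d by (simp add: tangent_map_def Let_def coord_deriv_def coord_rep_def)
  also have "v ?c = coord_deriv c ?c id p (v c)" using v c ch unfolding mem_tangent_space by blast
  also have "coord_deriv ?c d f p (coord_deriv c ?c id p (v c)) = coord_deriv c d f p (v c)"
    using coord_deriv_comp[OF A A smooth_map_id[OF A] f c ch(1) _ d(1), of "v c"] ch(2) d(2) by simp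
  finally show ?thesis .
qed

lemma tangent_map_in_tangent_space:
  assumes A: "smooth_atlas A" and B: "smooth_atlas B" and f: "smooth_map A B f"
    and v: "v \<in> tangent_space A p"
  shows "tangent_map A B f p v \<in> tangent_space B (f p)"
  unfolding mem_tangent_space
proof (intro conjI ballI impI allI)
  fix d e assume de: "d \<in> B" "e \<in> B" "f p \<in> chart_dom d" "f p \<in> chart_dom e"
  note ch = chart_at[OF A, of p]
  show "tangent_map A B f p v e = coord_deriv d e id (f p) (tangent_map A B f p v d)"
    using coord_deriv_comp[OF A B f smooth_map_id[OF B] ch de(1,3,2), of "v (chart_at A p)"] de
    by (simp add: tangent_map_apply[OF A f v ch])
next
  fix d assume "\<not> (d \<in> B \<and> f p \<in> chart_dom d)"
  then show "tangent_map A B f p v d = 0" by (auto simp: tangent_map_def Let_def)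
qed

lemma tangent_map_linear:
  assumes A: "smooth_atlas A" and f: "smooth_map A B f"
  shows "tangent_map A B f p (\<lambda>c. a *\<^sub>R v c + b *\<^sub>R w c) =
    (\<lambda>d. a *\<^sub>R tangent_map A B f p v d + b *\<^sub>R tangent_map A B f p w d)"
proof
  fix d
  show "tangent_map A B f p (\<lambda>c. a *\<^sub>R v c + b *\<^sub>R w c) d =
    a *\<^sub>R tangent_map A B f p v d + b *\<^sub>R tangent_map A B f p w d"
    using linear_coord_deriv[OF f chart_at(1)[OF A] _ chart_at(2)[OF A], of d p]
    by (auto simp: tangent_map_def Let_def coord_deriv_def coord_rep_def linear_add linear_cmul)
qed

text \<open>Both sides are tangent vectors at \<open>g (f p)\<close>, so it suffices to compare them
  in one chart, where the claim is the chain rule.\<close>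

lemma tangent_map_compose:
  assumes A: "smooth_atlas A" and B: "smooth_atlas B" and C: "smooth_atlas C"
    and f: "smooth_map A B f" and g: "smooth_map B C g" and gf: "smooth_map A C (g \<circ> f)"
    and v: "v \<in> tangent_space A p"
  shows "tangent_map B C g (f p) (tangent_map A B f p v) = tangent_map A C (g \<circ> f) p v"
proof -
  let ?c = "chart_at A p" and ?d = "chart_at B (f p)" and ?e = "chart_at C (g (f p))"
  have fv: "tangent_map A B f p v \<in> tangent_space B (f p)"
    by (rule tangent_map_in_tangent_space[OF A B f v])
  have 1: "tangent_map B C g (f p) (tangent_map A B f p v) \<in> tangent_space C (g (f p))"
    by (rule tangent_map_in_tangent_space[OF B C g fv])
  have 2: "tangent_map A C (g \<circ> f) p v \<in> tangent_space C (g (f p))"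
    using tangent_map_in_tangent_space[OF A C gf v] by simp
  show ?thesis
  proof (rule tangent_space_eqI[OF 1 2 chart_at[OF C]])
    show "tangent_map B C g (f p) (tangent_map A B f p v) ?e = tangent_map A C (g \<circ> f) p v ?e"
      using coord_deriv_comp[OF A B f g chart_at[OF A] chart_at[OF B] chart_at[OF C]]
        tangent_map_apply[OF B g fv chart_at[OF B] chart_at[OF C]]
        tangent_map_apply[OF A f v chart_at[OF A] chart_at[OF B]]
        tangent_map_apply[OF A gf v chart_at[OF A] chart_at(1)[OF C]] chart_at(2)[OF C, of "g (f p)"]
      by simp
  qed
qed

lemma tangent_map_id:
  assumes A: "smooth_atlas A" and v: "v \<in> tangent_space A p"
  shows "tangent_map A A id p v = v"
proof (rule tangent_space_eqI[OF _ v chart_at[OF A]])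
  show "tangent_map A A id p v \<in> tangent_space A p"
    using tangent_map_in_tangent_space[OF A A smooth_map_id[OF A] v] by simp
  show "tangent_map A A id p v (chart_at A p) = v (chart_at A p)"
    using tangent_map_apply[OF A smooth_map_id[OF A] v chart_at[OF A] chart_at(1)[OF A, of p]]
      chart_at[OF A] by (simp add: coord_deriv_id[OF A])
qed

lemma tangent_map_tangent_of_coords:
  assumes A: "smooth_atlas A" and B: "smooth_atlas B" and f: "smooth_map A B f"
    and c: "c \<in> A" "p \<in> chart_dom c" and d: "d \<in> B" "f p \<in> chart_dom d"
  shows "tangent_map A B f p (tangent_of_coords A c p u) =
    tangent_of_coords B d (f p) (coord_deriv c d f p u)"
proof (rule tangent_space_eqI[OF _ _ d])
  have u: "tangent_of_coords A c p u \<in> tangent_space A p"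
    by (rule tangent_of_coords_in_tangent_space[OF A c])
  show "tangent_map A B f p (tangent_of_coords A c p u) \<in> tangent_space B (f p)"
    by (rule tangent_map_in_tangent_space[OF A B f u])
  show "tangent_of_coords B d (f p) (coord_deriv c d f p u) \<in> tangent_space B (f p)"
    by (rule tangent_of_coords_in_tangent_space[OF B d])
  show "tangent_map A B f p (tangent_of_coords A c p u) d =
    tangent_of_coords B d (f p) (coord_deriv c d f p u) d"
    by (simp add: tangent_map_apply[OF A f u c d] tangent_of_coords_self[OF A c]
        tangent_of_coords_self[OF B d])
qed


section \<open>Pullback of differential forms\<close>

lemma local_form_chart_map:
  "is_chart c \<Longrightarrow> p \<in> chart_dom c \<Longrightarrow>
    local_form A c \<omega> (chart_map c p) us = \<omega> p (map (tangent_of_coords A c p) us)"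
  by (simp add: local_form_def chart_inv_chart_map)

text \<open>\<open>L\<close> has to respect pointwise linear combinations, the form in which
  \<open>tangent_map\<close> is linear.\<close>

lemma alternating_multilinear_compose:
  assumes w: "alternating_multilinear k T w"
    and LT: "\<And>x. x \<in> U \<Longrightarrow> L x \<in> T"
    and L: "\<And>a b x y. L (\<lambda>c. a *\<^sub>R x c + b *\<^sub>R y c) = (\<lambda>d. a *\<^sub>R L x d + b *\<^sub>R L y d)"
  shows "alternating_multilinear k U (\<lambda>vs. w (map L vs))"
  unfolding alternating_multilinear_def
proof (intro ballI impI conjI allI)
  fix vs assume vs: "vs \<in> lists U" "length vs = k"
  then have Lvs: "map L vs \<in> lists T" "length (map L vs) = k" using LT by auto
  show "w (map L (vs[i := (\<lambda>c. a *\<^sub>R x c + b *\<^sub>R y c)])) =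
      a * w (map L (vs[i := x])) + b * w (map L (vs[i := y]))"
    if "i < k" "x \<in> U" "y \<in> U" for i x y a b
    using w Lvs that LT unfolding alternating_multilinear_def map_update L by blast
  fix i j assume ij: "i < k" "j < k" "i \<noteq> j" "vs ! i = vs ! j"
  then have "map L vs ! i = map L vs ! j" using vs by simp
  then show "w (map L vs) = 0" using w Lvs ij unfolding alternating_multilinear_def by blast
qed

text \<open>Passes from indexed updates within a carrier to split lists over all coordinate
  vectors.\<close>

lemma alternating_multilinear_imp_alt_form:
  fixes L :: "'e::real_vector \<Rightarrow> 'c \<Rightarrow> 'f::real_vector"
  assumes w: "alternating_multilinear k T w"
    and LT: "\<And>x. L x \<in> T"
    and L: "\<And>a b x y. L (a *\<^sub>R x + b *\<^sub>R y) = (\<lambda>d. a *\<^sub>R L x d + b *\<^sub>R L y d)"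
  shows "alt_form k (\<lambda>us. w (map L us))"
  unfolding alt_form_def
proof (intro conjI allI impI)
  fix us vs :: "'e list" assume k: "length us + Suc (length vs) = k"
  have *: "w (map L (us @ (a *\<^sub>R x + b *\<^sub>R y) # vs)) =
      a * w (map L (us @ x # vs)) + b * w (map L (us @ y # vs))" for a b x y
  proof -
    \<comment> \<open>The entry \<open>L x\<close> is a placeholder: all three values in the claim
      arise by updating this slot.\<close>
    let ?l = "map L us @ L x # map L vs"
    have "?l \<in> lists T" "length ?l = k" "length us < k" using LT k by auto
    then have "w (?l[length us := (\<lambda>d. a *\<^sub>R L x d + b *\<^sub>R L y d)]) =
        a * w (?l[length us := L x]) + b * w (?l[length us := L y])"
      using w LT unfolding alternating_multilinear_def by blast
    then show ?thesis by (simp add: L list_update_append)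
  qed
  \<comment> \<open>Coefficients 1 and 1 give additivity, and second coefficient 0 gives
    homogeneity.\<close>
  show "linear (\<lambda>x. w (map L (us @ x # vs)))"
    using *[of 1 _ 1] *[of _ _ 0] by (intro linearI) simp_all
next
  fix us vs ws :: "'e list" and x assume k: "length us + length vs + length ws + 2 = k"
  let ?l = "map L (us @ x # vs @ x # ws)" and ?i = "length us" and ?j = "length us + Suc (length vs)"
  have "?l \<in> lists T" "length ?l = k" "?i < k" "?j < k" "?i \<noteq> ?j" using LT k by auto
  moreover have "?l ! ?i = ?l ! ?j" by (simp add: nth_append)
  ultimately show "w ?l = 0" using w unfolding alternating_multilinear_def by blast
qed

lemma alt_form_local_form:
  assumes A: "smooth_atlas A" and \<omega>: "differential_form A k \<omega>"
    and c: "c \<in> A" and y: "y \<in> chart_map c ` chart_dom c"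
  shows "alt_form k (local_form A c \<omega> y)"
proof -
  obtain p where p: "p \<in> chart_dom c" "y = chart_map c p" using y by blast
  have "local_form A c \<omega> y = (\<lambda>us. \<omega> p (map (tangent_of_coords A c p) us))"
    using local_form_chart_map[OF smooth_atlas_is_chart[OF A c] p(1)] p(2) by blast
  moreover have "alternating_multilinear k (tangent_space A p) (\<omega> p)"
    using \<omega> by (simp add: differential_form_def)
  ultimately show ?thesis
    using alternating_multilinear_imp_alt_form[OF _ tangent_of_coords_in_tangent_space[OF A c p(1)]
        tangent_of_coords_linear[OF A c p(1)]] by simp
qed

text \<open>The bridge to Euclidean spaces: where \<open>f\<close> maps into \<open>d\<close>, the
  local form of the pullback is the pullback of the local form along
  \<open>coord_rep c d f\<close>.\<close>

lemma local_form_pullback: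
  assumes A: "smooth_atlas A" and B: "smooth_atlas B" and f: "smooth_map A B f"
    and c: "c \<in> A" and d: "d \<in> B" and x: "x \<in> chart_map c ` (chart_dom c \<inter> f -` chart_dom d)"
  shows "local_form A c (pullback A B f \<omega>) x us =
    local_form B d \<omega> (coord_rep c d f x) (map (frechet_derivative (coord_rep c d f) (at x)) us)"
proof -
  obtain p where p: "p \<in> chart_dom c" "f p \<in> chart_dom d" "x = chart_map c p" using x by auto
  note cc = smooth_atlas_is_chart[OF A c] and dd = smooth_atlas_is_chart[OF B d]
  show ?thesis
    unfolding p(3) coord_rep_chart_map[OF cc p(1)] local_form_chart_map[OF cc p(1)]
      local_form_chart_map[OF dd p(2)] pullback_def map_map
    using tangent_map_tangent_of_coords[OF A B f c p(1) d p(2)]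
    by (simp add: o_def coord_deriv_def)
qed

lemma coord_rep_image:
  assumes "smooth_atlas A" "c \<in> A"
  shows "coord_rep c d f ` chart_map c ` (chart_dom c \<inter> f -` chart_dom d) \<subseteq> chart_map d ` chart_dom d"
  using smooth_atlas_is_chart[OF assms] by (auto simp: coord_rep_chart_map)

lemma differential_form_pullback:
  fixes A :: "('m::{t2_space,second_countable_topology}, 'e::euclidean_space) chart set"
  assumes A: "smooth_atlas A" and B: "smooth_atlas B" and f: "smooth_map A B f"
    and \<omega>: "differential_form B k \<omega>"
  shows "differential_form A k (pullback A B f \<omega>)"
  unfolding differential_form_def
proof (intro conjI allI ballI impI)
  fix p
  have "alternating_multilinear k (tangent_space B (f p)) (\<omega> (f p))"
    using \<omega> by (simp add: differential_form_def)
  from alternating_multilinear_compose[OF this tangent_map_in_tangent_space[OF A B f]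
      tangent_map_linear[OF A f]]
  show "alternating_multilinear k (tangent_space A p) (pullback A B f \<omega> p)"
    unfolding pullback_def .
next
  fix c and us :: "'e list" assume c: "c \<in> A" and us: "length us = k"
  show "smooth_on (chart_map c ` chart_dom c) (\<lambda>x. local_form A c (pullback A B f \<omega>) x us)"
  proof (rule smooth_on_local)
    fix x assume "x \<in> chart_map c ` chart_dom c"
    then obtain p where p: "p \<in> chart_dom c" "x = chart_map c p" by blast
    \<comment> \<open>No single target chart need contain the image of all of \<open>c\<close>, so
      smoothness is shown near each point with a chart around its image.\<close>
    define d where "d = chart_at B (f p)"
    have d: "d \<in> B" "f p \<in> chart_dom d" using chart_at[OF B] by (auto simp: d_def)
    define S where "S = chart_map c ` (chart_dom c \<inter> f -` chart_dom d)"
    define F where "F = coord_rep c d f"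
    have S: "open S" unfolding S_def by (rule open_coord_dom[OF A B f c d(1)])
    have F: "smooth_on S F" unfolding S_def F_def by (rule smooth_on_coord_rep[OF f c d(1)])
    have "smooth_on S (\<lambda>x. local_form B d \<omega> (F x)
        (map (\<lambda>g. g x) (map (\<lambda>u x. frechet_derivative F (at x) u) us) @ []))"
    proof (rule smooth_on_alt_form[OF S _ F])
      show "F ` S \<subseteq> chart_map d ` chart_dom d"
        unfolding F_def S_def by (rule coord_rep_image[OF A c])
      show "alt_form k (local_form B d \<omega> y)" if "y \<in> chart_map d ` chart_dom d" for y
        by (rule alt_form_local_form[OF B \<omega> d(1) that])
      show "smooth_on (chart_map d ` chart_dom d) (\<lambda>y. local_form B d \<omega> y ws)"
        if "length ws = k" for ws
        using \<omega> that d(1) unfolding differential_form_def by blast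
      show "smooth_on S g" if "g \<in> set (map (\<lambda>u x. frechet_derivative F (at x) u) us)" for g
        using that smooth_on_frechet_derivative[OF F] unfolding set_map by blast
    qed (use us in simp)
    then have "smooth_on S (\<lambda>x. local_form B d \<omega> (F x) (map (frechet_derivative F (at x)) us))"
      by (simp add: o_def)
    then have "smooth_on S (\<lambda>x. local_form A c (pullback A B f \<omega>) x us)"
      by (rule smooth_on_cong[OF S, THEN iffD2, rotated])
        (simp add: local_form_pullback[OF A B f c d(1)] S_def F_def)
    moreover have "x \<in> S" using p d by (simp add: S_def)
    ultimately show "\<exists>T. open T \<and> x \<in> T \<and>
        smooth_on T (\<lambda>x. local_form A c (pullback A B f \<omega>) x us)"
      using S by blast
  qed
qed

text \<open>\<open>frechet_derivative\<close> is a choice among all derivatives, and functions equal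
  near \<open>x\<close> have the same candidates; so the equality holds even at points of
  non-differentiability.\<close>

lemma frechet_derivative_cong_open:
  assumes "open S" "x \<in> S" "\<And>y. y \<in> S \<Longrightarrow> f y = g y"
  shows "frechet_derivative f (at x) = frechet_derivative g (at x)"
proof -
  have "(f has_derivative D) (at x) \<longleftrightarrow> (g has_derivative D) (at x)" for D
    using has_derivative_transform_within_open[OF _ assms(1,2)] assms(3) by metis
  then show ?thesis by (simp add: frechet_derivative_def)
qed

lemma euclidean_ext_deriv_cong:
  assumes "open S" "x \<in> S" "\<And>y us. y \<in> S \<Longrightarrow> \<eta> y us = \<theta> y us"
  shows "euclidean_ext_deriv \<eta> x us = euclidean_ext_deriv \<theta> x us"
  unfolding euclidean_ext_deriv_def
  by (intro sum.cong refl arg_cong2[of _ _ _ _ "(*)"]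
      fun_cong[OF frechet_derivative_cong_open[OF assms(1,2)]] assms(3))

text \<open>The two exterior derivatives are computed in the charts that \<open>chart_at\<close>
  picks at \<open>p\<close> and at \<open>f p\<close>. The Euclidean statement, applied to the
  coordinate expression of \<open>f\<close> between precisely these charts, compares them
  directly.\<close>

lemma ext_deriv_pullback:
  assumes A: "smooth_atlas A" and B: "smooth_atlas B" and f: "smooth_map A B f"
    and \<omega>: "differential_form B k \<omega>"
    and vs: "vs \<in> lists (tangent_space A p)" "length vs = Suc k"
  shows "ext_deriv A (pullback A B f \<omega>) p vs = pullback A B f (ext_deriv B \<omega>) p vs"
proof -
  define c d where "c = chart_at A p" and "d = chart_at B (f p)"
  have c: "c \<in> A" "p \<in> chart_dom c" and d: "d \<in> B" "f p \<in> chart_dom d"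
    using chart_at[OF A] chart_at[OF B] by (auto simp: c_def d_def)
  define S where "S = chart_map c ` (chart_dom c \<inter> f -` chart_dom d)"
  define F where "F = coord_rep c d f"
  let ?x = "chart_map c p" and ?us = "map (\<lambda>v. v c) vs"
  have S: "open S" unfolding S_def by (rule open_coord_dom[OF A B f c(1) d(1)])
  have x: "?x \<in> S" using c d by (simp add: S_def)
  have F: "smooth_on S F" unfolding S_def F_def by (rule smooth_on_coord_rep[OF f c(1) d(1)])
  have "ext_deriv A (pullback A B f \<omega>) p vs =
      euclidean_ext_deriv (local_form A c (pullback A B f \<omega>)) ?x ?us"
    by (simp add: ext_deriv_def c_def Let_def)
  also have "\<dots> = euclidean_ext_deriv
      (\<lambda>z vs. local_form B d \<omega> (F z) (map (frechet_derivative F (at z)) vs)) ?x ?us"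
    by (rule euclidean_ext_deriv_cong[OF S x])
      (simp add: local_form_pullback[OF A B f c(1) d(1)] S_def F_def)
  also have "\<dots> = euclidean_ext_deriv (local_form B d \<omega>) (F ?x) (map (frechet_derivative F (at ?x)) ?us)"
  proof (rule euclidean_ext_deriv_pullback[OF S x _ _ F])
    show "open (chart_map d ` chart_dom d)"
      using smooth_atlas_is_chart[OF B d(1)] by (simp add: is_chart_def)
    show "F ` S \<subseteq> chart_map d ` chart_dom d"
      unfolding F_def S_def by (rule coord_rep_image[OF A c(1)])
    show "alt_form k (local_form B d \<omega> y)" if "y \<in> chart_map d ` chart_dom d" for y
      by (rule alt_form_local_form[OF B \<omega> d(1) that])
    show "smooth_on (chart_map d ` chart_dom d) (\<lambda>y. local_form B d \<omega> y ws)"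
      if "length ws = k" for ws
      using \<omega> that d(1) unfolding differential_form_def by blast
  qed (use vs in simp)
  also have "F ?x = chart_map d (f p)"
    unfolding F_def by (rule coord_rep_chart_map[OF smooth_atlas_is_chart[OF A c(1)] c(2)])
  \<comment> \<open>The images of the coordinate vectors under DF are the
    \<open>d\<close>-coordinates of the images under the tangent map, as \<open>ext_deriv\<close> at
    \<open>f p\<close> expects.\<close>
  also have "map (frechet_derivative F (at ?x)) ?us = map (\<lambda>w. w d) (map (tangent_map A B f p) vs)"
    using vs(1) tangent_map_apply[OF A f _ c d] by (auto simp: F_def coord_deriv_def)
  finally show ?thesis unfolding pullback_def[of A B f "ext_deriv B \<omega>"] ext_deriv_def d_def Let_def .
qed


section \<open>The product manifold\<close>

definition prod_chart :: "('m, 'e) chart \<Rightarrow> ('n, 'f) chart \<Rightarrow> ('m \<times> 'n, 'e \<times> 'f) chart" where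
  "prod_chart c d = (chart_dom c \<times> chart_dom d, map_prod (chart_map c) (chart_map d))"

lemma prod_atlas_eq: "prod_atlas A B = {prod_chart c d | c d. c \<in> A \<and> d \<in> B}"
  by (simp add: prod_atlas_def prod_chart_def)

lemma prod_atlasI: "c \<in> A \<Longrightarrow> d \<in> B \<Longrightarrow> prod_chart c d \<in> prod_atlas A B"
  unfolding prod_atlas_eq by blast

lemma prod_atlasE:
  assumes "C \<in> prod_atlas A B"
  obtains c d where "C = prod_chart c d" "c \<in> A" "d \<in> B"
  using assms by (auto simp: prod_atlas_eq)

lemma chart_dom_prod_chart: "chart_dom (prod_chart c d) = chart_dom c \<times> chart_dom d"
  and chart_map_prod_chart: "chart_map (prod_chart c d) z = (chart_map c (fst z), chart_map d (snd z))"
  by (simp_all add: prod_chart_def map_prod_def split_def)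

lemma chart_map_image_prod_chart:
  "chart_map (prod_chart c d) ` (U \<times> V) = chart_map c ` U \<times> chart_map d ` V"
  by (force simp: chart_map_prod_chart)

text \<open>\<open>chart_inv\<close> is an \<open>inv_into\<close>, so its value is pinned down only
  on the chart image, by injectivity of the product map.\<close>

lemma chart_inv_prod_chart:
  assumes c: "is_chart c" and d: "is_chart d"
    and z: "fst z \<in> chart_map c ` chart_dom c" "snd z \<in> chart_map d ` chart_dom d"
  shows "chart_inv (prod_chart c d) z = (chart_inv c (fst z), chart_inv d (snd z))"
proof -
  obtain p q where pq: "p \<in> chart_dom c" "q \<in> chart_dom d" and "z = (chart_map c p, chart_map d q)"
    using z by (metis imageE prod.collapse)
  moreover have "inj_on (chart_map (prod_chart c d)) (chart_dom (prod_chart c d))"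
    by (rule inj_on_inverseI[of _ "\<lambda>z. (chart_inv c (fst z), chart_inv d (snd z))"])
      (auto simp: chart_dom_prod_chart chart_map_prod_chart chart_inv_chart_map[OF c]
        chart_inv_chart_map[OF d])
  ultimately show ?thesis
    unfolding chart_inv_def[of "prod_chart c d"]
    by (intro inv_into_f_eq)
      (auto simp: chart_dom_prod_chart chart_map_prod_chart chart_inv_chart_map[OF c]
        chart_inv_chart_map[OF d])
qed

lemma is_chart_prod_chart:
  assumes c: "is_chart c" and d: "is_chart d"
  shows "is_chart (prod_chart c d)"
proof -
  let ?C = "prod_chart c d"
  let ?U = "chart_map c ` chart_dom c" and ?V = "chart_map d ` chart_dom d"
  note hc = c[unfolded is_chart_def homeomorphism_def] and hd = d[unfolded is_chart_def homeomorphism_def]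
  have im: "chart_map ?C ` chart_dom ?C = ?U \<times> ?V"
    by (simp add: chart_dom_prod_chart chart_map_image_prod_chart)
  have inv: "chart_inv ?C z = (chart_inv c (fst z), chart_inv d (snd z))" if "z \<in> ?U \<times> ?V" for z
    using chart_inv_prod_chart[OF c d, of z] that by auto
  have "continuous_on (chart_dom c \<times> chart_dom d) (\<lambda>z. (chart_map c (fst z), chart_map d (snd z)))"
    using hc hd by (auto intro!: continuous_on_Pair continuous_on_compose2[of _ "chart_map c" _ fst]
        continuous_on_compose2[of _ "chart_map d" _ snd] continuous_on_fst continuous_on_snd continuous_on_id)
  then have cont: "continuous_on (chart_dom ?C) (chart_map ?C)"
    by (simp add: chart_dom_prod_chart chart_map_prod_chart cong: continuous_on_cong)
  have "continuous_on (?U \<times> ?V) (\<lambda>z. (chart_inv c (fst z), chart_inv d (snd z)))"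
    using hc hd by (auto intro!: continuous_on_Pair continuous_on_compose2[of _ "chart_inv c" _ fst]
        continuous_on_compose2[of _ "chart_inv d" _ snd] continuous_on_fst continuous_on_snd continuous_on_id)
  then have cont_inv: "continuous_on (?U \<times> ?V) (chart_inv ?C)"
    using inv by (simp cong: continuous_on_cong)
  have "chart_inv ?C (chart_map ?C z) = z" if "z \<in> chart_dom ?C" for z
    using that inv[of "chart_map ?C z"]
    by (auto simp: chart_dom_prod_chart chart_map_prod_chart chart_inv_chart_map[OF c]
        chart_inv_chart_map[OF d])
  then have "homeomorphism (chart_dom ?C) (?U \<times> ?V) (chart_map ?C) (chart_inv ?C)"
    using cont cont_inv unfolding im[symmetric] by (intro homeomorphismI) auto
  then show ?thesis
    unfolding is_chart_def im using hc hd by (auto simp: chart_dom_prod_chart open_Times)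
qed

lemma smooth_on_compose_fst:
  fixes g :: "'a::euclidean_space \<Rightarrow> 'c::real_normed_vector"
  assumes "open S" "open (T :: 'b::euclidean_space set)" "smooth_on S g"
  shows "smooth_on (S \<times> T) (\<lambda>z. g (fst z))"
  using smooth_on_compose[OF open_Times[OF assms(1,2)] _
      smooth_on_linear[OF open_Times[OF assms(1,2)] bounded_linear_fst] assms(3)]
  by (auto simp: o_def)

lemma smooth_on_compose_snd:
  fixes g :: "'a::euclidean_space \<Rightarrow> 'c::real_normed_vector"
  assumes "open (T :: 'b::euclidean_space set)" "open S" "smooth_on S g"
  shows "smooth_on (T \<times> S) (\<lambda>z. g (snd z))"
  using smooth_on_compose[OF open_Times[OF assms(1,2)] _
      smooth_on_linear[OF open_Times[OF assms(1,2)] bounded_linear_snd] assms(3)]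
  by (auto simp: o_def)

lemma smooth_atlas_prod:
  fixes A :: "('m::{t2_space,second_countable_topology}, 'e::euclidean_space) chart set"
    and B :: "('n::{t2_space,second_countable_topology}, 'f::euclidean_space) chart set"
  assumes A: "smooth_atlas A" and B: "smooth_atlas B"
  shows "smooth_atlas (prod_atlas A B)"
  unfolding smooth_atlas_def
proof (intro conjI ballI)
  fix C assume "C \<in> prod_atlas A B"
  then show "is_chart C"
    by (elim prod_atlasE) (use smooth_atlas_is_chart[OF A] smooth_atlas_is_chart[OF B]
        is_chart_prod_chart in blast)
next
  have "\<exists>C\<in>prod_atlas A B. (p, q) \<in> chart_dom C" for p q
    by (rule bexI[OF _ prod_atlasI[OF chart_at(1)[OF A, of p] chart_at(1)[OF B, of q]]])
      (simp add: chart_dom_prod_chart chart_at A B)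
  then show "(\<Union>C\<in>prod_atlas A B. chart_dom C) = UNIV" by fastforce
next
  fix C D assume "C \<in> prod_atlas A B" "D \<in> prod_atlas A B"
  then obtain c d c' d' where C: "C = prod_chart c d" "c \<in> A" "d \<in> B"
    and D: "D = prod_chart c' d'" "c' \<in> A" "d' \<in> B" by (metis prod_atlasE)
  note cc = smooth_atlas_is_chart[OF A C(2)] and dd = smooth_atlas_is_chart[OF B C(3)]
  let ?U = "chart_map c ` (chart_dom c \<inter> chart_dom c')" and ?V = "chart_map d ` (chart_dom d \<inter> chart_dom d')"
  have eq: "chart_map C ` (chart_dom C \<inter> chart_dom D) = ?U \<times> ?V"
    unfolding C D chart_dom_prod_chart Times_Int_Times chart_map_image_prod_chart ..
  have op: "open ?U" "open ?V"
    using open_coord_dom[OF A A smooth_map_id[OF A] C(2) D(2)]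
      open_coord_dom[OF B B smooth_map_id[OF B] C(3) D(3)] by simp_all
  have sm: "smooth_on ?U (transition c c')" "smooth_on ?V (transition d d')"
    using A B C D unfolding smooth_atlas_def by blast+
  have "smooth_on (?U \<times> ?V) (\<lambda>z. (transition c c' (fst z), transition d d' (snd z)))"
    by (intro smooth_on_Pair open_Times op smooth_on_compose_fst smooth_on_compose_snd sm)
  then have "smooth_on (?U \<times> ?V) (transition C D)"
    by (rule smooth_on_cong[OF open_Times[OF op], THEN iffD2, rotated])
      (auto simp: C D transition_def chart_inv_prod_chart[OF cc dd] chart_map_prod_chart)
  then show "smooth_on (chart_map C ` (chart_dom C \<inter> chart_dom D)) (transition C D)"
    unfolding eq .
qed

text \<open>In a product chart the projection reads as a transition map of the first factor after
  \<open>fst\<close>.\<close>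

lemma smooth_map_fst:
  assumes A: "smooth_atlas A" and B: "smooth_atlas B"
  shows "smooth_map (prod_atlas A B) A fst"
  unfolding smooth_map_def
proof (intro conjI ballI)
  fix C e assume "C \<in> prod_atlas A B" and e: "e \<in> A"
  then obtain c d where C: "C = prod_chart c d" "c \<in> A" "d \<in> B" by (metis prod_atlasE)
  note cc = smooth_atlas_is_chart[OF A C(2)] and dd = smooth_atlas_is_chart[OF B C(3)]
  let ?U = "chart_map c ` (chart_dom c \<inter> chart_dom e)" and ?V = "chart_map d ` chart_dom d"
  have "chart_dom C \<inter> fst -` chart_dom e = (chart_dom c \<inter> chart_dom e) \<times> chart_dom d"
    by (auto simp: C chart_dom_prod_chart)
  then have eq: "chart_map C ` (chart_dom C \<inter> fst -` chart_dom e) = ?U \<times> ?V"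
    by (simp add: C chart_map_image_prod_chart)
  have op: "open ?U" "open ?V"
    using open_coord_dom[OF A A smooth_map_id[OF A] C(2) e] dd by (auto simp: is_chart_def)
  have "smooth_on ?U (transition c e)" using A C e unfolding smooth_atlas_def by blast
  then have "smooth_on (?U \<times> ?V) (\<lambda>z. transition c e (fst z))"
    by (rule smooth_on_compose_fst[OF op])
  then have "smooth_on (?U \<times> ?V) (chart_map e \<circ> fst \<circ> chart_inv C)"
    by (rule smooth_on_cong[OF open_Times[OF op], THEN iffD2, rotated])
      (auto simp: C transition_def chart_inv_prod_chart[OF cc dd])
  then show "smooth_on (chart_map C ` (chart_dom C \<inter> fst -` chart_dom e)) (chart_map e \<circ> fst \<circ> chart_inv C)"
    unfolding eq .
qed (intro continuous_intros)

lemma smooth_map_snd: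
  assumes A: "smooth_atlas A" and B: "smooth_atlas B"
  shows "smooth_map (prod_atlas A B) B snd"
  unfolding smooth_map_def
proof (intro conjI ballI)
  fix C e assume "C \<in> prod_atlas A B" and e: "e \<in> B"
  then obtain c d where C: "C = prod_chart c d" "c \<in> A" "d \<in> B" by (metis prod_atlasE)
  note cc = smooth_atlas_is_chart[OF A C(2)] and dd = smooth_atlas_is_chart[OF B C(3)]
  let ?U = "chart_map c ` chart_dom c" and ?V = "chart_map d ` (chart_dom d \<inter> chart_dom e)"
  have "chart_dom C \<inter> snd -` chart_dom e = chart_dom c \<times> (chart_dom d \<inter> chart_dom e)"
    by (auto simp: C chart_dom_prod_chart)
  then have eq: "chart_map C ` (chart_dom C \<inter> snd -` chart_dom e) = ?U \<times> ?V"
    by (simp add: C chart_map_image_prod_chart)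
  have op: "open ?U" "open ?V"
    using open_coord_dom[OF B B smooth_map_id[OF B] C(3) e] cc by (auto simp: is_chart_def)
  have "smooth_on ?V (transition d e)" using B C e unfolding smooth_atlas_def by blast
  then have "smooth_on (?U \<times> ?V) (\<lambda>z. transition d e (snd z))"
    by (rule smooth_on_compose_snd[OF op])
  then have "smooth_on (?U \<times> ?V) (chart_map e \<circ> snd \<circ> chart_inv C)"
    by (rule smooth_on_cong[OF open_Times[OF op], THEN iffD2, rotated])
      (auto simp: C transition_def chart_inv_prod_chart[OF cc dd])
  then show "smooth_on (chart_map C ` (chart_dom C \<inter> snd -` chart_dom e)) (chart_map e \<circ> snd \<circ> chart_inv C)"
    unfolding eq .
qed (intro continuous_intros)

text \<open>With the identity as first component this gives smoothness of the graph
  embedding.\<close>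

lemma smooth_map_Pair:
  fixes A :: "('m::{t2_space,second_countable_topology}, 'e::euclidean_space) chart set"
  assumes A: "smooth_atlas A" and B: "smooth_atlas B" and C: "smooth_atlas C"
    and f: "smooth_map A B f" and g: "smooth_map A C g"
  shows "smooth_map A (prod_atlas B C) (\<lambda>p. (f p, g p))"
  unfolding smooth_map_def
proof (intro conjI ballI)
  show "continuous_on UNIV (\<lambda>p. (f p, g p))"
    using f g by (auto simp: smooth_map_def intro: continuous_on_Pair)
next
  fix c D assume c: "c \<in> A" and "D \<in> prod_atlas B C"
  then obtain d e where D: "D = prod_chart d e" "d \<in> B" "e \<in> C" by (metis prod_atlasE)
  let ?S = "chart_map c ` (chart_dom c \<inter> (\<lambda>p. (f p, g p)) -` chart_dom D)"
  have "open (chart_dom d)" "open (chart_dom e)"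
    using smooth_atlas_is_chart[OF B D(2)] smooth_atlas_is_chart[OF C D(3)] by (auto simp: is_chart_def)
  then have "open (f -` chart_dom d \<inter> g -` chart_dom e)"
    by (intro open_Int smooth_map_vimage_open[OF f] smooth_map_vimage_open[OF g])
  moreover have "(\<lambda>p. (f p, g p)) -` chart_dom D = f -` chart_dom d \<inter> g -` chart_dom e"
    by (auto simp: D chart_dom_prod_chart)
  ultimately have S: "open ?S" using open_chart_image[OF smooth_atlas_is_chart[OF A c]] by simp
  have "smooth_on ?S (\<lambda>x. (coord_rep c d f x, coord_rep c e g x))"
    by (intro smooth_on_Pair S smooth_on_subset[OF smooth_on_coord_rep[OF f c D(2)]]
        smooth_on_subset[OF smooth_on_coord_rep[OF g c D(3)]])
      (auto simp: D chart_dom_prod_chart)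
  moreover have "chart_map D \<circ> (\<lambda>p. (f p, g p)) \<circ> chart_inv c =
      (\<lambda>x. (coord_rep c d f x, coord_rep c e g x))"
    by (auto simp: D chart_map_prod_chart coord_rep_def)
  ultimately show "smooth_on ?S (chart_map D \<circ> (\<lambda>p. (f p, g p)) \<circ> chart_inv c)" by simp
qed

section \<open>Restriction of the vanishing defect to the graph\<close>

theorem proposition4:
  fixes A :: "('m::{t2_space,second_countable_topology}, 'e::euclidean_space) chart set"
    and n :: nat
    and \<Omega> \<alpha> \<alpha>' :: "('m, 'e) form"
    and \<Lambda> :: "('m \<times> 'm, 'e \<times> 'e) form"
    and f :: "'m \<Rightarrow> 'm" and j :: "'m \<Rightarrow> 'm \<times> 'm"
  assumes "smooth_atlas A" and "DIM('e) = n" and "n \<ge> 2"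
    and "volume_form A \<Omega>" and "exact_form A n \<Omega>"
    and "differential_form A (n - 1) \<alpha>" and "form_eq A n (ext_deriv A \<alpha>) \<Omega>"
    and "differential_form A (n - 1) \<alpha>'" and "form_eq A n (ext_deriv A \<alpha>') \<Omega>"
    and "generates A \<alpha> \<alpha>' \<Lambda> f"
    and "j = (\<lambda>m. (m, f m))"
  shows "exact_volume_preserving A \<alpha> \<alpha>' f \<and>
    differential_form A (n - 2) (pullback A (prod_atlas A A) j \<Lambda>) \<and>
    form_eq A (n - 1) (form_diff (pullback A A f \<alpha>') \<alpha>)
      (ext_deriv A (pullback A (prod_atlas A A) j \<Lambda>))"
proof -
  let ?N = "prod_atlas A A" and ?L = "pullback A (prod_atlas A A) j \<Lambda>"
  note A = assms(1) and n = assms(2)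
  have N: "smooth_atlas ?N" by (rule smooth_atlas_prod[OF A A])
  \<comment> \<open>\<open>j m\<close> is a point of the graph, and the graph is the zero set of the
    defect.\<close>
  have \<Lambda>: "differential_form ?N (n - 2) \<Lambda>" and f: "smooth_map A A f"
    and graph: "form_vanishes_at ?N (n - 1) (generating_defect A \<alpha> \<alpha>' \<Lambda>) (j m)" for m
    using assms(10) unfolding generates_def n assms(11) by blast+
  have j: "smooth_map A ?N j"
    using smooth_map_Pair[OF A A A smooth_map_id[OF A] f] unfolding assms(11) by simp
  have fst_j: "fst \<circ> j = id" and snd_j: "snd \<circ> j = f" by (auto simp: assms(11))
  have \<lambda>: "differential_form A (n - 2) ?L" by (rule differential_form_pullback[OF A N j \<Lambda>])
  moreover have eq: "form_eq A (n - 1) (form_diff (pullback A A f \<alpha>') \<alpha>) (ext_deriv A ?L)"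
    unfolding form_eq_def
  proof (intro allI ballI impI)
    fix m vs assume vs: "vs \<in> lists (tangent_space A m)" "length vs = n - 1"
    have fst_jm: "fst (j m) = m" and snd_jm: "snd (j m) = f m" by (simp_all add: assms(11))
    \<comment> \<open>Evaluating the defect on these vectors is evaluating its pullback along
      \<open>j\<close> on \<open>vs\<close>.\<close>
    let ?ws = "map (tangent_map A ?N j m) vs"
    have "?ws \<in> lists (tangent_space ?N (j m))"
      using vs(1) tangent_map_in_tangent_space[OF A N j] by auto
    then have "generating_defect A \<alpha> \<alpha>' \<Lambda> (j m) ?ws = 0"
      using graph[of m] vs(2) unfolding form_vanishes_at_def by simp
    \<comment> \<open>Functoriality of tangent maps collapses \<pi>_2 \<circ> j to \<open>f\<close>
      here, and \<pi>_1 \<circ> j to \<open>id\<close> below.\<close>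
    moreover have "map (tangent_map ?N A snd (j m)) ?ws = map (tangent_map A A f m) vs"
      using tangent_map_compose[OF A N A j smooth_map_snd[OF A A]] f vs(1)
      by (auto simp: snd_j)
    moreover have "map (tangent_map ?N A fst (j m)) ?ws = vs"
      using tangent_map_compose[OF A N A j smooth_map_fst[OF A A]] smooth_map_id[OF A] vs(1)
      by (auto simp: fst_j tangent_map_id[OF A] intro!: map_idI)
    \<comment> \<open>The degrees match because n \<ge> 2 gives \<open>n - 1 = Suc (n - 2)\<close>
      in truncated subtraction.\<close>
    moreover have "ext_deriv A ?L m vs = ext_deriv ?N \<Lambda> (j m) ?ws"
      using ext_deriv_pullback[OF A N j \<Lambda> vs(1)] vs(2) assms(3) by (simp add: pullback_def)
    ultimately show "form_diff (pullback A A f \<alpha>') \<alpha> m vs = ext_deriv A ?L m vs"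
      by (simp only: generating_defect_def form_diff_def pullback_def fst_jm snd_jm)
  qed
  ultimately show ?thesis using f unfolding exact_volume_preserving_def n by blast
qed

end
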